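(* Let $d,n\in\mathbb{N}$ and let $U\subseteq \mathbb{R}^d$ be a set of $n$ points. Then there exists a deterministic two-party communication protocol for Learning Halfspaces over $U$ whose communication complexity is $O(d\log d\log n)$.
   Context: A halfspace in $\mathbb{R}^d$ is a set of the form $\{x\in\mathbb{R}^d:\langle a,x\rangle< b\}$ or $\{x\in\mathbb{R}^d:\langle a,x\rangle\le b\}$ with $a\in\mathbb{R}^d$, $b\in\mathbb{R}$. An example is a pair $(u,y)\in U\times\{\pm1\}$ (positive if $y=+1$, negative if $y=-1$); a sample is a set of examples. Learning Halfspaces over $U$ is the following two-party search problem: Alice holds a sample $S_a\subseteq U\times\{\pm1\}$ and Bob holds a sample $S_b\subseteq U\times\{\pm1\}$, with the promise that there exists a halfspace containing all positive examples of $S_a\cup S_b$ and no negative example of $S_a\cup S_b$. The players must output a function $f:U\to\{\pm1\}$ with $f(x)=y$ for every $(x,y)\in S_a\cup S_b$ ($f$ need not be the indicator of a halfspace). The communication complexity of a protocol is the worst-case number of bits exchanged. *)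

theory Defs
  imports Complex_Main "Jordan_Normal_Form.Matrix"
begin

section \<open>Deterministic two-party protocols\<close>

text \<open>A protocol is a finite binary tree. At an inner node the named player sends one bit that
  depends on that player's own input only; the bits sent so far are encoded by the position in the
  tree. A leaf carries the common output, which is hence determined by the transcript.\<close>

datatype ('a, 'b, 'o) protocol =
    Output 'o
  | Alice "'a \<Rightarrow> bool" "('a, 'b, 'o) protocol" "('a, 'b, 'o) protocol"
  | Bob "'b \<Rightarrow> bool" "('a, 'b, 'o) protocol" "('a, 'b, 'o) protocol"

fun run :: "('a, 'b, 'o) protocol \<Rightarrow> 'a \<Rightarrow> 'b \<Rightarrow> 'o" where
  "run (Output z) a b = z"
| "run (Alice g P Q) a b = (if g a then run P a b else run Q a b)"
| "run (Bob g P Q) a b = (if g b then run P a b else run Q a b)"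

fun bits_exchanged :: "('a, 'b, 'o) protocol \<Rightarrow> 'a \<Rightarrow> 'b \<Rightarrow> nat" where
  "bits_exchanged (Output z) a b = 0"
| "bits_exchanged (Alice g P Q) a b =
     Suc (if g a then bits_exchanged P a b else bits_exchanged Q a b)"
| "bits_exchanged (Bob g P Q) a b =
     Suc (if g b then bits_exchanged P a b else bits_exchanged Q a b)"

lemma bits_exchanged_bounded: "\<exists>k. \<forall>a b. bits_exchanged P a b \<le> k"
proof (induction P)
  case (Output z)
  then show ?case by simp
next
  case (Alice g P Q)
  then obtain k l where "\<And>a b. bits_exchanged P a b \<le> k" "\<And>a b. bits_exchanged Q a b \<le> l"
    by blast
  then have "\<forall>a b. bits_exchanged (Alice g P Q) a b \<le> Suc (max k l)"
    by (auto simp: le_max_iff_disj)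
  then show ?case by blast
next
  case (Bob g P Q)
  then obtain k l where "\<And>a b. bits_exchanged P a b \<le> k" "\<And>a b. bits_exchanged Q a b \<le> l"
    by blast
  then have "\<forall>a b. bits_exchanged (Bob g P Q) a b \<le> Suc (max k l)"
    by (auto simp: le_max_iff_disj)
  then show ?case by blast
qed

text \<open>The worst case over a set \<open>D\<close> of admissible input pairs. The supremum is a genuine maximum
  for nonempty \<open>D\<close>, as the next lemma shows.\<close>

definition communication_complexity :: "('a \<times> 'b) set \<Rightarrow> ('a, 'b, 'o) protocol \<Rightarrow> nat" where
  "communication_complexity D P = (SUP (a, b) \<in> D. bits_exchanged P a b)"

lemma communication_complexity_le_iff:
  assumes "D \<noteq> {}"
  shows "communication_complexity D P \<le> k \<longleftrightarrow> (\<forall>(a, b) \<in> D. bits_exchanged P a b \<le> k)"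
proof -
  have "bdd_above ((\<lambda>(a, b). bits_exchanged P a b) ` D)"
  proof -
    obtain k where "\<And>a b. bits_exchanged P a b \<le> k"
      using bits_exchanged_bounded[of P] by blast
    then show ?thesis
      by (intro bdd_aboveI[of _ k]) auto
  qed
  then show ?thesis
    unfolding communication_complexity_def using assms by (auto simp: cSUP_le_iff)
qed


section \<open>Learning halfspaces\<close>

definition halfspace :: "nat \<Rightarrow> real vec set \<Rightarrow> bool" where
  "halfspace d H \<longleftrightarrow> (\<exists>a \<in> carrier_vec d. \<exists>b.
     H = {x \<in> carrier_vec d. a \<bullet> x < b} \<or> H = {x \<in> carrier_vec d. a \<bullet> x \<le> b})"

type_synonym sample = "(real vec \<times> int) set"

definition sample_over :: "real vec set \<Rightarrow> sample \<Rightarrow> bool" where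
  "sample_over U S \<longleftrightarrow> S \<subseteq> U \<times> {1, -1}"

definition halfspace_inputs :: "nat \<Rightarrow> real vec set \<Rightarrow> (sample \<times> sample) set" where
  "halfspace_inputs d U = {(Sa, Sb). sample_over U Sa \<and> sample_over U Sb \<and>
     (\<exists>H. halfspace d H \<and> (\<forall>x. (x, 1) \<in> Sa \<union> Sb \<longrightarrow> x \<in> H) \<and>
          (\<forall>x. (x, -1) \<in> Sa \<union> Sb \<longrightarrow> x \<notin> H))}"

text \<open>A function on \<open>U\<close> is represented by a total function whose values off \<open>U\<close> are irrelevant.\<close>

definition learns_halfspaces ::
  "nat \<Rightarrow> real vec set \<Rightarrow> (sample, sample, real vec \<Rightarrow> int) protocol \<Rightarrow> bool" where
  "learns_halfspaces d U P \<longleftrightarrow> (\<forall>(Sa, Sb) \<in> halfspace_inputs d U.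
     (\<forall>x \<in> U. run P Sa Sb x \<in> {1, -1}) \<and> (\<forall>(x, y) \<in> Sa \<union> Sb. run P Sa Sb x = y))"

text \<open>In the asymptotic bound \<open>d log d log n\<close> each logarithm is read as being at least 1. This
  changes nothing for \<open>d, n \<ge> 2\<close>; for \<open>d = 1\<close> or \<open>n = 1\<close> the bare product is 0, although
  communication is needed.\<close>

definition log_pos :: "nat \<Rightarrow> real" where
  "log_pos k = max 1 (log 2 (real k))"

end

theory Submission
  imports Defs "HOL-Library.Function_Algebras" "HOL-Library.FuncSet"
begin

text \<open>Homogenising, a halfspace becomes a vector \<open>h\<close> in dimension \<open>k = d + 1\<close> and every point a
  hyperplane in the space of such vectors. For a random sample of polynomially (in \<open>k\<close>) many points,
  every cone spanned by \<open>k\<close> extreme rays of the arrangement of the sample that no sampled hyperplane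
  crosses is crossed by at most a quarter of all hyperplanes (a Clarkson--Shor argument: such a cone is
  determined by \<open>k\<^sup>2\<close> sample points). Every \<open>h\<close> lies in such a cone, obtained by repeatedly shooting from
  a canonical ray of the current cell, through \<open>h\<close>, to a facet; the cone is encoded by the initial cell
  and the \<open>k\<close> facets, which leaves \<open>k ^ O(k)\<close> cones. Each cone yields a container, a set that contains
  the points of every halfspace \<open>h\<close> in the cone and at most a quarter of all points in excess.

  To separate one player's positive from one player's negative points, note that one side of a
  separating hyperplane has at most half of the current domain. Its player names a container of that
  side in \<open>O(d log d)\<close> bits, everything outside gets the opposite label, and the domain shrinks by a
  factor of \<open>3/4\<close>.\<close>


section \<open>Cells of a hyperplane arrangement\<close>

text \<open>The dimension \<open>k\<close> varies with \<open>d\<close>, so vectors are functions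
  that vanish from index \<open>k\<close> on, inside one ambient space that supplies span and
  independence.\<close>

interpretation fun_space: vector_space "\<lambda>(c::real) (f::nat \<Rightarrow> real). (\<lambda>i. c * f i)"
  by unfold_locales (auto simp: fun_eq_iff algebra_simps)

definition dot :: "nat \<Rightarrow> (nat \<Rightarrow> real) \<Rightarrow> (nat \<Rightarrow> real) \<Rightarrow> real" where
  "dot k f g = (\<Sum>i<k. f i * g i)"

definition coord_space :: "nat \<Rightarrow> (nat \<Rightarrow> real) set" where
  "coord_space k = {f. \<forall>i\<ge>k. f i = 0}"

definition std_basis :: "nat \<Rightarrow> (nat \<Rightarrow> real) set" where
  "std_basis k = (\<lambda>i j. if j = i then 1 else 0) ` {..<k}"

lemma finite_std_basis [simp]: "finite (std_basis k)"
  by (simp add: std_basis_def)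

lemma card_std_basis_le: "card (std_basis k) \<le> k"
  unfolding std_basis_def using card_image_le[of "{..<k}"] by simp

lemma std_basis_subset: "std_basis k \<subseteq> coord_space k"
  by (auto simp: std_basis_def coord_space_def)

lemma dot_zero_left [simp]: "dot k (\<lambda>i. 0) x = 0"
  by (simp add: dot_def)

lemma dot_scale_left [simp]: "dot k (\<lambda>i. c * f i) x = c * dot k f x"
  by (simp add: dot_def sum_distrib_left mult.assoc)

lemma dot_add_left [simp]: "dot k (\<lambda>i. f i + g i) x = dot k f x + dot k g x"
  by (simp add: dot_def sum.distrib algebra_simps)

lemma dot_diff_left [simp]: "dot k (\<lambda>i. f i - g i) x = dot k f x - dot k g x"
  by (simp add: dot_def sum_subtractf algebra_simps)

lemma dot_uminus_left [simp]: "dot k (\<lambda>i. - f i) x = - dot k f x"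
  by (simp add: dot_def sum_negf)

lemma dot_unit: "i < k \<Longrightarrow> dot k f (\<lambda>j. if j = i then 1 else 0) = f i"
  by (simp add: dot_def if_distrib cong: if_cong)

lemma zero_in_coord_space [simp]: "(\<lambda>i. 0) \<in> coord_space k"
  by (simp add: coord_space_def)

lemma dot_zero_on_span:
  assumes "x \<in> fun_space.span I" "\<And>y. y \<in> I \<Longrightarrow> dot k h y = 0"
  shows "dot k h x = 0"
  using assms(1)
proof (induction rule: fun_space.span_induct_alt)
  case base
  then show ?case by (simp add: dot_def)
next
  case (step c x y)
  have "dot k h ((\<lambda>i. c * x i) + y) = c * dot k h x + dot k h y"
    by (simp add: dot_def sum.distrib sum_distrib_left algebra_simps)
  also have "\<dots> = 0" using step assms(2) by simp
  finally show ?case .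
qed

lemma ex_std_basis_dot_nonzero:
  assumes "h \<in> coord_space k" "h \<noteq> (\<lambda>i. 0)"
  shows "\<exists>e\<in>std_basis k. dot k h e \<noteq> 0"
proof -
  from assms obtain i where "i < k" "h i \<noteq> 0"
    unfolding coord_space_def by (metis (mono_tags, lifting) mem_Collect_eq not_le ext)
  then show ?thesis
    unfolding std_basis_def using dot_unit[of i k h] by (intro bexI[OF _ imageI]) auto
qed

lemma coord_space_subset_span: "coord_space k \<subseteq> fun_space.span (std_basis k)"
proof
  fix f assume f: "f \<in> coord_space k"
  have "f = (\<Sum>i<k. (\<lambda>j. f i * (if j = i then 1 else 0)))"
  proof
    fix j
    have "(\<Sum>i<k. (\<lambda>j. f i * (if j = i then 1 else 0))) j = (\<Sum>i<k. f i * (if j = i then 1 else 0))"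
      by (induction k) auto
    also have "\<dots> = f j"
      using f by (auto simp: coord_space_def if_distrib not_less cong: if_cong)
    finally show "f j = (\<Sum>i<k. (\<lambda>j. f i * (if j = i then 1 else 0))) j" ..
  qed
  also have "\<dots> \<in> fun_space.span (std_basis k)"
    by (intro fun_space.span_sum fun_space.span_scale fun_space.span_base) (auto simp: std_basis_def)
  finally show "f \<in> fun_space.span (std_basis k)" .
qed

lemma independent_coord_space:
  assumes "fun_space.independent I" "I \<subseteq> coord_space k"
  shows "finite I \<and> card I \<le> k"
  using fun_space.independent_span_bound[OF finite_std_basis assms(1)]
    assms(2) coord_space_subset_span card_std_basis_le order_trans by blast

text \<open>The functional of \<open>h\<close> vanishes on the span of \<open>I\<close> but not at
  \<open>x\<close>, so \<open>x\<close> lies outside that span.\<close>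

lemma independent_insert_dot:
  assumes "fun_space.independent I" "\<And>y. y \<in> I \<Longrightarrow> dot k h y = 0" "dot k h x \<noteq> 0"
  shows "fun_space.independent (insert x I)" "x \<notin> I"
proof -
  have "x \<notin> fun_space.span I"
    using dot_zero_on_span[of x I k h] assms by blast
  then show "fun_space.independent (insert x I)" "x \<notin> I"
    using assms(1) fun_space.independent_insertI fun_space.span_base by blast+
qed

section \<open>Counting the sign patterns of an arrangement\<close>

text \<open>The orthogonality to \<open>I\<close> lets the count recurse into hyperplanes;
  \<open>restrict\<close> makes patterns equal exactly when they agree on \<open>N\<close>.\<close>

definition sign_vectors ::
  "nat \<Rightarrow> (nat \<Rightarrow> real) set \<Rightarrow> (nat \<Rightarrow> real) set \<Rightarrow> ((nat \<Rightarrow> real) \<Rightarrow> real) set" where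
  "sign_vectors k N I =
     (\<lambda>h. restrict (\<lambda>x. sgn (dot k h x)) N) ` {h \<in> coord_space k. \<forall>y\<in>I. dot k h y = 0}"

text \<open>Some positive multiple of a point on the segment from \<open>h\<close> to
  \<open>h'\<close> lies on the hyperplane of \<open>x\<close>. Its signs on \<open>N\<close> are
  those of both ends, since these agree on \<open>N\<close>.\<close>

lemma opposite_signs_cross:
  assumes h: "h \<in> coord_space k" "\<forall>y\<in>I. dot k h y = 0"
    and h': "h' \<in> coord_space k" "\<forall>y\<in>I. dot k h' y = 0"
    and eq: "\<forall>y\<in>N. sgn (dot k h y) = sgn (dot k h' y)"
    and ne: "sgn (dot k h x) \<noteq> sgn (dot k h' x)"
  shows "restrict (\<lambda>x. sgn (dot k h x)) N \<in> sign_vectors k N (insert x I)"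
proof -
  define a where "a = \<bar>dot k h x\<bar>"
  define b where "b = \<bar>dot k h' x\<bar>"
  \<comment> \<open>Each vector is weighted by the absolute value of the other at \<open>x\<close>,
    so the two contributions at \<open>x\<close> cancel.\<close>
  define g where "g = (\<lambda>i. b * h i + a * h' i)"
  have ab: "a \<ge> 0" "b \<ge> 0" "a > 0 \<or> b > 0"
    using ne by (auto simp: a_def b_def)
  have g: "dot k g y = b * dot k h y + a * dot k h' y" for y
    by (simp add: g_def)
  have "dot k g x = 0"
    using ne unfolding g a_def b_def by (auto simp: sgn_if split: if_splits)
  then have 1: "g \<in> coord_space k" "\<forall>y\<in>insert x I. dot k g y = 0"
    using h h' by (auto simp: g) (auto simp: g_def coord_space_def)
  have 2: "sgn (dot k g y) = sgn (dot k h y)" if "y \<in> N" for y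
  proof -
    have e: "sgn (dot k h y) = sgn (dot k h' y)" using eq that by blast
    consider "dot k h y = 0" "dot k h' y = 0" | "dot k h y > 0" "dot k h' y > 0"
      | "dot k h y < 0" "dot k h' y < 0"
      using e by (auto simp: sgn_if split: if_splits)
    then show ?thesis
    proof cases
      case 2
      then have "dot k g y > 0"
        unfolding g using ab by (metis add_nonneg_pos add_pos_nonneg less_eq_real_def mult_nonneg_nonneg mult_pos_pos)
      with 2 show ?thesis by simp
    next
      case 3
      then have "b * (- dot k h y) + a * (- dot k h' y) > 0"
        using ab by (metis add_nonneg_pos add_pos_nonneg less_eq_real_def mult_nonneg_nonneg mult_pos_pos neg_0_less_iff_less)
      then have "dot k g y < 0" unfolding g by simp
      with 3 show ?thesis by simp
    qed (simp add: g)
  qed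
  show ?thesis
    unfolding sign_vectors_def by (rule image_eqI[of _ _ g]) (use 1 2 in auto)
qed

text \<open>Deletion and restriction, with \<open>w\<close> the dimension of the subspace orthogonal
  to \<open>I\<close>. A pattern on \<open>N\<close> extends to \<open>x\<close> in up to three ways
  if it also occurs on the hyperplane of \<open>x\<close>, which has dimension \<open>w - 1\<close>,
  and in only one way otherwise. So f(n+1, w) <= f(n, w) + 2 f(n, w-1), which (2n+1)^w
  satisfies.\<close>

lemma card_sign_vectors:
  assumes "finite N" "N \<subseteq> coord_space k"
    and "fun_space.independent I" "I \<subseteq> coord_space k" "card I + w = k"
  shows "finite (sign_vectors k N I) \<and> card (sign_vectors k N I) \<le> (2 * card N + 1) ^ w"
  using assms
proof (induction N arbitrary: I w rule: finite_induct)
  case empty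
  have "sign_vectors k {} I \<subseteq> {\<lambda>x. undefined}"
    by (auto simp: sign_vectors_def)
  then show ?case
    by (metis card.empty card_mono finite.emptyI finite.insertI is_singletonI is_singleton_altdef
        mult_0_right add_0 power_one finite_subset)
next
  case (insert x N)
  let ?S = "sign_vectors k N I"
  have upd: "restrict f (insert x N) = (restrict f N)(x := f x)" for f :: "(nat \<Rightarrow> real) \<Rightarrow> real"
    by (auto simp: restrict_def)
  have IH: "finite ?S" "card ?S \<le> (2 * card N + 1) ^ w"
    using insert.IH[of I w] insert.prems by auto
  show ?case
  proof (cases "x \<in> fun_space.span I")
    case True
    \<comment> \<open>Here \<open>x\<close> is a combination of \<open>I\<close>, so its sign is 0
      throughout the subspace.\<close>
    then have "sign_vectors k (insert x N) I \<subseteq> (\<lambda>\<tau>. \<tau>(x := 0)) ` ?S"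
      unfolding sign_vectors_def upd using dot_zero_on_span[OF True] by fastforce
    then have "finite (sign_vectors k (insert x N) I)" "card (sign_vectors k (insert x N) I) \<le> card ?S"
      using IH(1) by (auto intro: finite_subset surj_card_le)
    moreover have "(2 * card N + 1) ^ w \<le> (2 * card (insert x N) + 1) ^ w"
      using insert.hyps by (intro power_mono) auto
    ultimately show ?thesis using IH(2) by auto
  next
    case False
    then have ind: "fun_space.independent (insert x I)" "x \<notin> I"
      using insert.prems fun_space.independent_insertI fun_space.span_base by blast+
    have sub: "insert x I \<subseteq> coord_space k" using insert.prems by auto
    have "finite I" using independent_coord_space insert.prems by blast
    then have "card (insert x I) = Suc (card I)" using ind by simp
    moreover have "card (insert x I) \<le> k" using independent_coord_space[OF ind(1) sub] by blast
    ultimately obtain w' where w: "w = Suc w'" "card (insert x I) + w' = k"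
      using insert.prems by (cases w) auto
    let ?S' = "sign_vectors k N (insert x I)"
    have IH': "finite ?S'" "card ?S' \<le> (2 * card N + 1) ^ w'"
      using insert.IH[of "insert x I" w'] insert.prems ind sub w by auto
    \<comment> \<open>The sign at \<open>x\<close> of some vector with pattern
      \<open>\<tau>\<close>; for \<open>\<tau>\<close> outside \<open>?S'\<close> all vectors with
      that pattern share it.\<close>
    define a where "a = (\<lambda>\<tau>. SOME s. \<exists>h\<in>coord_space k. (\<forall>y\<in>I. dot k h y = 0) \<and>
      restrict (\<lambda>y. sgn (dot k h y)) N = \<tau> \<and> s = sgn (dot k h x))"
    \<comment> \<open>\<open>?A\<close> holds one extension of every pattern, \<open>?B\<close> and
      \<open>?C\<close> the two further ones of the patterns in \<open>?S'\<close>.\<close>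
    let ?A = "(\<lambda>\<tau>. \<tau>(x := if \<tau> \<in> ?S' then 0 else a \<tau>)) ` ?S"
    let ?B = "(\<lambda>\<tau>. \<tau>(x := 1)) ` ?S'" and ?C = "(\<lambda>\<tau>. \<tau>(x := -1)) ` ?S'"
    have "sign_vectors k (insert x N) I \<subseteq> ?A \<union> ?B \<union> ?C"
    proof
      fix \<rho> assume "\<rho> \<in> sign_vectors k (insert x N) I"
      then obtain h where h: "h \<in> coord_space k" "\<forall>y\<in>I. dot k h y = 0"
        and \<rho>: "\<rho> = (restrict (\<lambda>y. sgn (dot k h y)) N)(x := sgn (dot k h x))"
        unfolding sign_vectors_def upd by auto
      define \<tau> where "\<tau> = restrict (\<lambda>y. sgn (dot k h y)) N"
      have \<tau>S: "\<tau> \<in> ?S" using h unfolding sign_vectors_def \<tau>_def by blast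
      show "\<rho> \<in> ?A \<union> ?B \<union> ?C"
      proof (cases "\<tau> \<in> ?S'")
        case True
        have "sgn (dot k h x) \<in> {0, 1, -1}" by (auto simp: sgn_if)
        then show ?thesis
          using True \<tau>S unfolding \<rho> \<tau>_def[symmetric] by auto
      next
        case notin: False
        have "\<exists>g\<in>coord_space k. (\<forall>y\<in>I. dot k g y = 0) \<and>
            restrict (\<lambda>y. sgn (dot k g y)) N = \<tau> \<and> a \<tau> = sgn (dot k g x)"
          unfolding a_def by (rule someI_ex) (use h \<tau>_def in blast)
        then obtain g where g: "g \<in> coord_space k" "\<forall>y\<in>I. dot k g y = 0"
          "restrict (\<lambda>y. sgn (dot k g y)) N = \<tau>" "a \<tau> = sgn (dot k g x)" by blast
        have "\<forall>y\<in>N. sgn (dot k h y) = sgn (dot k g y)"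
          using g(3) unfolding \<tau>_def by (metis restrict_apply')
        then have "sgn (dot k h x) = sgn (dot k g x)"
          using opposite_signs_cross[OF h g(1,2)] notin \<tau>_def by blast
        then have "\<rho> = \<tau>(x := if \<tau> \<in> ?S' then 0 else a \<tau>)"
          using notin g(4) \<rho> \<tau>_def by simp
        then show ?thesis using \<tau>S by blast
      qed
    qed
    moreover have fin: "finite (?A \<union> ?B \<union> ?C)" using IH IH' by auto
    moreover have "card (?A \<union> ?B \<union> ?C) \<le> card ?S + card ?S' + card ?S'"
      by (intro order_trans[OF card_Un_le] add_mono card_image_le IH(1) IH'(1))
    ultimately have *: "finite (sign_vectors k (insert x N) I)"
      "card (sign_vectors k (insert x N) I) \<le> card ?S + card ?S' + card ?S'"
      by (meson finite_subset, meson card_mono order_trans)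
    have "card ?S + card ?S' + card ?S' \<le> (2 * card N + 1) ^ w' * (2 * card N + 3)"
      using IH(2) IH'(2) w by (auto simp: algebra_simps)
    also have "\<dots> \<le> (2 * card N + 3) ^ w' * (2 * card N + 3)"
      by (intro mult_right_mono power_mono) auto
    also have "\<dots> = (2 * card (insert x N) + 1) ^ w"
      using insert.hyps w by (simp add: algebra_simps numeral_eq_Suc)
    finally show ?thesis using * by simp
  qed
qed

section \<open>Cells and their extreme rays\<close>

text \<open>The closed cell: signs may degenerate to 0, so \<open>\<sigma>(x := 0)\<close> describes
  its face on the hyperplane of \<open>x\<close>.\<close>

definition cell :: "nat \<Rightarrow> (nat \<Rightarrow> real) set \<Rightarrow> ((nat \<Rightarrow> real) \<Rightarrow> real) \<Rightarrow> (nat \<Rightarrow> real) set" where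
  "cell k N \<sigma> = {g \<in> coord_space k. \<forall>x\<in>N. dot k g x = 0 \<or> sgn (dot k g x) = \<sigma> x}"

text \<open>If the common zeros of \<open>T\<close> form a line, these are its two opposite vectors
  of l1 norm 1; otherwise there are none.\<close>

definition rays :: "nat \<Rightarrow> (nat \<Rightarrow> real) set \<Rightarrow> (nat \<Rightarrow> real) set" where
  "rays k T = {v \<in> coord_space k. (\<Sum>i<k. \<bar>v i\<bar>) = 1 \<and> (\<forall>x\<in>T. dot k v x = 0) \<and>
     (\<forall>w\<in>coord_space k. (\<forall>x\<in>T. dot k w x = 0) \<longrightarrow> (\<exists>c. w = (\<lambda>i. c * v i)))}"

text \<open>The zero vector pads lists of generators to a fixed length; it never affects which points a
  set of vectors crosses.\<close>

definition generators :: "nat \<Rightarrow> (nat \<Rightarrow> real) set \<Rightarrow> (nat \<Rightarrow> real) set" where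
  "generators k N = insert (\<lambda>i. 0) (\<Union>T\<in>{T. T \<subseteq> N \<and> finite T \<and> card T \<le> k}. rays k T)"

lemma card_rays: "finite (rays k T) \<and> card (rays k T) \<le> 2"
proof (cases "rays k T = {}")
  case False
  then obtain v where v: "v \<in> rays k T" by blast
  have "rays k T \<subseteq> {v, \<lambda>i. - v i}"
  proof
    fix w assume w: "w \<in> rays k T"
    then obtain c where c: "w = (\<lambda>i. c * v i)"
      using v unfolding rays_def by blast
    have "(\<Sum>i<k. \<bar>w i\<bar>) = \<bar>c\<bar> * (\<Sum>i<k. \<bar>v i\<bar>)"
      by (simp add: c abs_mult sum_distrib_left)
    then have "\<bar>c\<bar> = 1" using v w by (simp add: rays_def)
    then have "c = 1 \<or> c = -1" by auto
    then show "w \<in> {v, \<lambda>i. - v i}" using c by auto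
  qed
  moreover have "card {v, \<lambda>i. - v i} \<le> 2"
    by (simp add: card_insert_if)
  ultimately show ?thesis
    by (meson card_mono finite.emptyI finite.insertI finite_subset order_trans)
qed simp

text \<open>Two rays for each subset of \<open>N\<close>, plus the zero vector. Ignoring the size
  limit on the subsets is affordable: the bound is applied to at most \<open>k * k + k\<close>
  vectors, and the sample size, cubic in \<open>k\<close>, makes up for it.\<close>

lemma card_generators:
  assumes "finite N"
  shows "finite (generators k N) \<and> card (generators k N) \<le> 2 ^ (card N + 2)"
proof -
  let ?P = "{T. T \<subseteq> N \<and> finite T \<and> card T \<le> k}"
  have P: "finite ?P" "card ?P \<le> 2 ^ card N"
    using assms card_mono[of "Pow N" ?P] by (auto simp: card_Pow intro: finite_subset[of _ "Pow N"])
  have "card (\<Union>T\<in>?P. rays k T) \<le> (\<Sum>T\<in>?P. card (rays k T))"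
    using P(1) by (rule card_UN_le)
  also have "\<dots> \<le> (\<Sum>T\<in>?P. 2)"
    using card_rays by (intro sum_mono) blast
  also have "\<dots> \<le> 2 * 2 ^ card N" using P by simp
  finally have *: "card (\<Union>T\<in>?P. rays k T) \<le> 2 * 2 ^ card N" .
  have f: "finite (\<Union>T\<in>?P. rays k T)" using P(1) card_rays by blast
  have "card (generators k N) \<le> Suc (card (\<Union>T\<in>?P. rays k T))"
    unfolding generators_def by (rule card_insert_le_m1) (use f in auto)
  also have "\<dots> \<le> Suc (2 * 2 ^ card N)" using * by simp
  also have "\<dots> \<le> 2 ^ (card N + 2)"
    using one_le_power[of "2::nat" "card N"] by (simp del: one_le_power)
  finally show ?thesis using f unfolding generators_def by simp
qed

lemma generators_mono: "N \<subseteq> N' \<Longrightarrow> generators k N \<subseteq> generators k N'"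
  unfolding generators_def by blast

text \<open>A maximal independent subset of \<open>Z\<close> spans \<open>Z\<close>, so it has the
  same common zeros.\<close>

lemma ex_small_same_kernel:
  assumes "Z \<subseteq> coord_space k"
  obtains T where "T \<subseteq> Z" "finite T" "card T \<le> k"
    "\<And>w. (\<forall>x\<in>T. dot k w x = 0) \<Longrightarrow> (\<forall>x\<in>Z. dot k w x = 0)"
proof -
  obtain T where T: "T \<subseteq> Z" "fun_space.independent T" "Z \<subseteq> fun_space.span T"
    using fun_space.maximal_independent_subset[of Z] by blast
  show ?thesis
  proof (rule that[OF T(1)])
    show "finite T" "card T \<le> k"
      using independent_coord_space T assms by blast+
    show "\<forall>x\<in>Z. dot k w x = 0" if "\<forall>x\<in>T. dot k w x = 0" for w
      using dot_zero_on_span that T(3) by blast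
  qed
qed

text \<open>A nonzero point of the cell with the largest number of tight constraints spans an extreme
  ray: moving it along another direction of its tight space would make one more constraint
  tight. The standard basis among the constraints makes every cell pointed.\<close>

lemma ex_extreme_ray:
  assumes N: "finite N" "std_basis k \<subseteq> N" "N \<subseteq> coord_space k"
    and h: "h \<in> cell k N \<sigma>" "h \<noteq> (\<lambda>i. 0)"
  shows "\<exists>v \<in> generators k N \<inter> cell k N \<sigma>. v \<noteq> (\<lambda>i. 0)"
proof -
  define Z where "Z g = {x \<in> N. dot k g x = 0}" for g
  define ok where "ok g \<longleftrightarrow> g \<in> cell k N \<sigma> \<and> g \<noteq> (\<lambda>i. 0)" for g
  have "\<forall>g. ok g \<longrightarrow> card (Z g) < Suc (card N)"
    using N(1) by (auto simp: Z_def less_Suc_eq_le intro: card_mono)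
  moreover have "ok h" using h ok_def by blast
  ultimately obtain g where g: "ok g" and max: "\<And>g'. ok g' \<Longrightarrow> card (Z g') \<le> card (Z g)"
    using ex_has_greatest_nat[of ok h "\<lambda>g. card (Z g)" "Suc (card N)"] by blast
  have gk: "g \<in> coord_space k" using g ok_def cell_def by auto
  have mult: "\<exists>c. w = (\<lambda>i. c * g i)" if w: "w \<in> coord_space k" "\<forall>x\<in>Z g. dot k w x = 0" for w
  proof (cases "w = (\<lambda>i. 0)")
    case True
    then show ?thesis by (intro exI[of _ 0]) auto
  next
    case False
    define Y where "Y = {x \<in> N. dot k w x \<noteq> 0}"
    have Y: "finite Y" "Y \<noteq> {}"
      using ex_std_basis_dot_nonzero[OF w(1) False] N by (auto simp: Y_def)
    \<comment> \<open>Ratio test: \<open>t\<close> is the step of least absolute value along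
      \<open>w\<close> that makes a constraint in \<open>Y\<close> tight, hence no sign on
      \<open>N\<close> flips.\<close>
    define r where "r x = \<bar>dot k g x / dot k w x\<bar>" for x
    obtain x0 where x0: "x0 \<in> Y" "\<And>x. x \<in> Y \<Longrightarrow> r x0 \<le> r x"
      using Y by (metis arg_min_if_finite(1) arg_min_least)
    define t where "t = dot k g x0 / dot k w x0"
    define g' where "g' = (\<lambda>i. g i - t * w i)"
    have g'd: "dot k g' x = dot k g x - t * dot k w x" for x
      by (simp add: g'_def)
    have le: "\<bar>t * dot k w x\<bar> \<le> \<bar>dot k g x\<bar>" if "x \<in> N" for x
    proof (cases "x \<in> Y")
      case True
      then have "\<bar>t\<bar> \<le> \<bar>dot k g x\<bar> / \<bar>dot k w x\<bar>"
        using x0(2)[OF True] by (simp add: r_def t_def)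
      then show ?thesis using True by (simp add: Y_def abs_mult pos_le_divide_eq)
    qed (use that in \<open>simp add: Y_def\<close>)
    have cell': "g' \<in> cell k N \<sigma>"
    proof -
      have "dot k g' x = 0 \<or> sgn (dot k g' x) = \<sigma> x" if x: "x \<in> N" for x
      proof -
        have "dot k g x = 0 \<or> sgn (dot k g x) = \<sigma> x"
          using g x by (auto simp: ok_def cell_def)
        moreover have "dot k g' x = 0 \<or> sgn (dot k g' x) = sgn (dot k g x)"
          using le[OF x] unfolding g'd by (auto simp: sgn_if)
        ultimately show ?thesis using le[OF x] unfolding g'd by auto
      qed
      moreover have "g' \<in> coord_space k"
        using gk w(1) by (auto simp: g'_def coord_space_def)
      ultimately show ?thesis by (simp add: cell_def)
    qed
    have "dot k g' x0 = 0" unfolding g'd t_def using x0(1) by (simp add: Y_def)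
    moreover have "x0 \<notin> Z g" using x0(1) w(2) by (auto simp: Y_def)
    moreover have "Z g \<subseteq> Z g'" using w(2) by (auto simp: Z_def g'd)
    ultimately have "Z g \<subset> Z g'" using x0(1) by (auto simp: Z_def Y_def)
    then have "card (Z g) < card (Z g')"
      using N(1) by (intro psubset_card_mono) (auto simp: Z_def)
    \<comment> \<open>A nonzero \<open>g'\<close> would have more tight constraints than the
      maximum, so \<open>g'\<close> is zero and \<open>g\<close> is a multiple of
      \<open>w\<close>.\<close>
    then have "\<not> ok g'" using max[of g'] by auto
    then have "g' = (\<lambda>i. 0)" using cell' ok_def by auto
    then have "g' i = 0" for i by simp
    then have "g i = t * w i" for i by (simp add: g'_def)
    then have gt: "g = (\<lambda>i. t * w i)" by (rule ext)
    then have "t \<noteq> 0" using g by (auto simp: ok_def)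
    then show ?thesis using gt by (intro exI[of _ "1 / t"]) auto
  qed
  define s where "s = (\<Sum>i<k. \<bar>g i\<bar>)"
  obtain i where "g i \<noteq> 0" using g by (auto simp: ok_def fun_eq_iff)
  moreover from this have "i < k"
    using gk by (auto simp: coord_space_def not_le[symmetric])
  ultimately have s: "s > 0"
    unfolding s_def by (intro sum_pos2[of _ i]) auto
  define v where "v = (\<lambda>i. (1 / s) * g i)"
  have vd: "dot k v x = (1 / s) * dot k g x" for x unfolding v_def by (rule dot_scale_left)
  have vk: "v \<in> coord_space k" using gk by (auto simp: v_def coord_space_def)
  have "sgn (dot k v x) = sgn (dot k g x)" for x
    using s unfolding vd by (simp add: sgn_if field_simps)
  then have vcell: "v \<in> cell k N \<sigma>"
    using g vk s vd unfolding ok_def cell_def by auto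
  have vn: "v \<noteq> (\<lambda>i. 0)"
    using \<open>g i \<noteq> 0\<close> s by (auto simp: v_def fun_eq_iff)
  obtain T where T: "T \<subseteq> Z g" "finite T" "card T \<le> k"
    "\<And>w. (\<forall>x\<in>T. dot k w x = 0) \<Longrightarrow> (\<forall>x\<in>Z g. dot k w x = 0)"
    using ex_small_same_kernel[of "Z g" k] N(3) by (auto simp: Z_def)
  have "v \<in> rays k T"
  proof -
    have "(\<Sum>i<k. \<bar>v i\<bar>) = 1"
      using s by (simp add: v_def abs_mult sum_divide_distrib[symmetric] s_def[symmetric])
    moreover have "\<forall>x\<in>T. dot k v x = 0" using T(1) by (auto simp: vd Z_def)
    moreover have "\<exists>c. w = (\<lambda>i. c * v i)"
      if w: "w \<in> coord_space k" "\<forall>x\<in>T. dot k w x = 0" for w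
    proof -
      obtain c where "w = (\<lambda>i. c * g i)" using mult[OF w(1) T(4)[OF w(2)]] by blast
      then show ?thesis using s by (intro exI[of _ "c * s"]) (auto simp: v_def)
    qed
    ultimately show ?thesis using vk by (simp add: rays_def)
  qed
  moreover have "T \<subseteq> N" using T(1) Z_def by auto
  ultimately have "v \<in> generators k N" using T unfolding generators_def by blast
  then show ?thesis using vcell vn by blast
qed

section \<open>Covering a vector by a chain of rays\<close>

text \<open>A fixed choice per cell, so naming the cell names the ray; the zero vector is the
  default when the cell contains nothing else.\<close>

definition cell_ray ::
  "nat \<Rightarrow> (nat \<Rightarrow> real) set \<Rightarrow> ((nat \<Rightarrow> real) \<Rightarrow> real) \<Rightarrow> nat \<Rightarrow> real" where
  "cell_ray k N \<sigma> = (SOME v. v \<in> generators k N \<inter> cell k N \<sigma> \<and>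
     ((\<exists>h\<in>cell k N \<sigma>. h \<noteq> (\<lambda>i. 0)) \<longrightarrow> v \<noteq> (\<lambda>i. 0)))"

text \<open>The decoder: the rays are recovered from the initial cell and the facets alone, without
  \<open>h\<close>.\<close>

fun ray_chain ::
  "nat \<Rightarrow> (nat \<Rightarrow> real) set \<Rightarrow> ((nat \<Rightarrow> real) \<Rightarrow> real) \<Rightarrow> (nat \<Rightarrow> real) list \<Rightarrow> (nat \<Rightarrow> real) list"
where
  "ray_chain k N \<sigma> [] = []"
| "ray_chain k N \<sigma> (x # xs) = cell_ray k N \<sigma> # ray_chain k N (\<sigma>(x := 0)) xs"

lemma length_ray_chain [simp]: "length (ray_chain k N \<sigma> xs) = length xs"
  by (induction xs arbitrary: \<sigma>) auto

lemma cell_ray: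
  assumes "finite N" "std_basis k \<subseteq> N" "N \<subseteq> coord_space k"
  shows "cell_ray k N \<sigma> \<in> generators k N" "cell_ray k N \<sigma> \<in> cell k N \<sigma>"
    "\<lbrakk>h \<in> cell k N \<sigma>; h \<noteq> (\<lambda>i. 0)\<rbrakk> \<Longrightarrow> cell_ray k N \<sigma> \<noteq> (\<lambda>i. 0)"
proof -
  have zero: "(\<lambda>i. 0) \<in> generators k N \<inter> cell k N \<sigma>"
    by (simp add: generators_def cell_def)
  have "\<exists>v. v \<in> generators k N \<inter> cell k N \<sigma> \<and> ((\<exists>h\<in>cell k N \<sigma>. h \<noteq> (\<lambda>i. 0)) \<longrightarrow> v \<noteq> (\<lambda>i. 0))"
  proof (cases "\<exists>h\<in>cell k N \<sigma>. h \<noteq> (\<lambda>i. 0)")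
    case True
    then show ?thesis using ex_extreme_ray[OF assms] by blast
  next
    case False
    then show ?thesis using zero by blast
  qed
  from someI_ex[OF this, folded cell_ray_def]
  show "cell_ray k N \<sigma> \<in> generators k N" "cell_ray k N \<sigma> \<in> cell k N \<sigma>"
    "\<lbrakk>h \<in> cell k N \<sigma>; h \<noteq> (\<lambda>i. 0)\<rbrakk> \<Longrightarrow> cell_ray k N \<sigma> \<noteq> (\<lambda>i. 0)"
    by blast+
qed

lemma cell_zero_subset: "cell k N (\<sigma>(x := 0)) \<subseteq> cell k N \<sigma>"
  by (auto simp: cell_def sgn_eq_0_iff split: if_splits)

text \<open>Each step passes to a face, so all rays stay in the initial cell. This is what keeps
  every vector of \<open>N\<close> from crossing their cone.\<close>

lemma ray_chain_subset:
  assumes "finite N" "std_basis k \<subseteq> N" "N \<subseteq> coord_space k"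
  shows "set (ray_chain k N \<sigma> xs) \<subseteq> generators k N \<inter> cell k N \<sigma>"
proof (induction xs arbitrary: \<sigma>)
  case (Cons x xs)
  show ?case
    using cell_ray(1,2)[OF assms, of \<sigma>] Cons.IH[of "\<sigma>(x := 0)"] cell_zero_subset[of k N \<sigma> x]
    unfolding ray_chain.simps list.set insert_subset by blast
qed simp

text \<open>Subtract from \<open>h\<close> the largest multiple of the ray of its cell that keeps it in the cell.
  A constraint becomes tight on which the ray does not vanish, so the dimension drops.\<close>

lemma ex_ray_chain:
  assumes N: "finite N" "std_basis k \<subseteq> N" "N \<subseteq> coord_space k" "N \<noteq> {}"
    and I: "fun_space.independent I" "I \<subseteq> N" "\<forall>x\<in>I. \<sigma> x = 0" "card I + w = k"
    and h: "h \<in> cell k N \<sigma>"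
  shows "\<exists>xs. set xs \<subseteq> N \<and> length xs = w \<and>
    (\<forall>x. (dot k h x < 0 \<longrightarrow> (\<exists>v\<in>set (ray_chain k N \<sigma> xs). dot k v x < 0)) \<and>
         (dot k h x > 0 \<longrightarrow> (\<exists>v\<in>set (ray_chain k N \<sigma> xs). dot k v x > 0)))"
  using I h
proof (induction w arbitrary: I \<sigma> h)
  case (0 I \<sigma> h)
  have hI: "h \<in> coord_space k" "\<forall>x\<in>I. dot k h x = 0"
    using 0 by (auto simp: cell_def sgn_eq_0_iff)
  \<comment> \<open>\<open>h\<close> vanishes on \<open>k\<close> independent vectors; a basis
    vector on which it does not vanish would extend them to \<open>k + 1\<close>.\<close>
  have "h = (\<lambda>i. 0)"
  proof (rule ccontr)
    assume "h \<noteq> (\<lambda>i. 0)"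
    then obtain e where e: "e \<in> std_basis k" "dot k h e \<noteq> 0"
      using ex_std_basis_dot_nonzero hI by blast
    then have "fun_space.independent (insert e I)" "e \<notin> I"
      using independent_insert_dot[OF 0(1), of k h e] hI by auto
    moreover have "insert e I \<subseteq> coord_space k" using e 0 N by auto
    ultimately have "card (insert e I) \<le> k" "finite I"
      using independent_coord_space[of "insert e I" k] by auto
    then show False using \<open>e \<notin> I\<close> 0 by simp
  qed
  then show ?case by simp
next
  case (Suc w I \<sigma> h)
  show ?case
  proof (cases "h = (\<lambda>i. 0)")
    case True
    \<comment> \<open>The zero vector has no signs to account for; the list is only padded to its
      length.\<close>
    obtain x where "x \<in> N" using N(4) by blast
    then show ?thesis
      using True by (intro exI[of _ "replicate (Suc w) x"]) auto
  next
    case False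
    define v where "v = cell_ray k N \<sigma>"
    have v: "v \<in> cell k N \<sigma>" "v \<noteq> (\<lambda>i. 0)"
      using cell_ray[OF N(1-3)] Suc.prems False unfolding v_def by blast+
    then have vI: "v \<in> coord_space k" "\<forall>x\<in>I. dot k v x = 0"
      using Suc.prems by (auto simp: cell_def sgn_eq_0_iff)
    define Y where "Y = {x \<in> N. dot k v x \<noteq> 0}"
    have Y: "finite Y" "Y \<noteq> {}"
      using ex_std_basis_dot_nonzero[OF vI(1) v(2)] N by (auto simp: Y_def)
    \<comment> \<open>The least ratio is the largest multiple of \<open>v\<close> that can be
      subtracted before \<open>h\<close> leaves the cell, and \<open>x0\<close> is a facet hit
      there. Ratios are nonnegative because \<open>h\<close> and \<open>v\<close> share a closed
      cell.\<close>
    define x0 where "x0 = arg_min_on (\<lambda>x. dot k h x / dot k v x) Y"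
    have x0: "x0 \<in> Y" "\<And>x. x \<in> Y \<Longrightarrow> dot k h x0 / dot k v x0 \<le> dot k h x / dot k v x"
      unfolding x0_def by (rule arg_min_if_finite(1)[OF Y], rule arg_min_least[OF Y])
    define t where "t = dot k h x0 / dot k v x0"
    define h' where "h' = (\<lambda>i. h i - t * v i)"
    have h'd: "dot k h' x = dot k h x - t * dot k v x" for x by (simp add: h'_def)
    have same: "dot k h x = 0 \<or> sgn (dot k h x) = sgn (dot k v x)" if "x \<in> Y" for x
      using that v(1) Suc.prems(5) unfolding Y_def cell_def by fastforce
    have t0: "t \<ge> 0"
      using same[OF x0(1)] unfolding t_def by (auto simp: sgn_if divide_simps split: if_splits)
    have zero: "dot k h' x0 = 0" using x0(1) by (simp add: h'd t_def Y_def)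
    have "h' \<in> cell k N (\<sigma>(x0 := 0))"
    proof -
      have "dot k h' x = 0 \<or> sgn (dot k h' x) = (\<sigma>(x0 := 0)) x" if x: "x \<in> N" for x
      proof (cases "x = x0")
        case True
        then show ?thesis using zero by simp
      next
        case ne: False
        have hx: "dot k h x = 0 \<or> sgn (dot k h x) = \<sigma> x" using x Suc.prems(5) by (auto simp: cell_def)
        show ?thesis
        proof (cases "x \<in> Y")
          case True
          have *: "t \<le> dot k h x / dot k v x" using x0(2)[OF True] t_def by simp
          have vs: "sgn (dot k v x) = \<sigma> x" using True v(1) by (auto simp: Y_def cell_def)
          consider "dot k v x > 0" | "dot k v x < 0" using True by (force simp: Y_def)
          then have "dot k h' x = 0 \<or> sgn (dot k h' x) = sgn (dot k v x)"
          proof cases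
            case 1
            then have "t * dot k v x \<le> dot k h x" using * by (simp add: pos_le_divide_eq)
            then show ?thesis using 1 unfolding h'd by (auto simp: sgn_if)
          next
            case 2
            then have "t * dot k v x \<ge> dot k h x" using * by (simp add: neg_le_divide_eq)
            then show ?thesis using 2 unfolding h'd by (auto simp: sgn_if)
          qed
          then show ?thesis using vs ne by auto
        next
          case False
          then show ?thesis using x ne hx by (simp add: Y_def h'd)
        qed
      qed
      moreover have "h' \<in> coord_space k"
        using vI(1) Suc.prems(5) by (auto simp: h'_def coord_space_def cell_def)
      ultimately show ?thesis by (simp add: cell_def)
    qed
    moreover have ind: "fun_space.independent (insert x0 I)" "x0 \<notin> I"
      by (rule independent_insert_dot[OF Suc.prems(1), of k v]; use vI(2) x0(1) Y_def in blast)+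
    moreover have "finite I"
      using Suc.prems(2) N(1) finite_subset by blast
    then have "card (insert x0 I) + w = k"
      using ind Suc.prems(4) by simp
    moreover have "insert x0 I \<subseteq> N" "\<forall>x\<in>insert x0 I. (\<sigma>(x0 := 0)) x = 0"
      using Suc.prems x0(1) by (auto simp: Y_def)
    ultimately obtain xs where xs: "set xs \<subseteq> N" "length xs = w"
      "\<And>x. dot k h' x < 0 \<Longrightarrow> \<exists>v\<in>set (ray_chain k N (\<sigma>(x0 := 0)) xs). dot k v x < 0"
      "\<And>x. dot k h' x > 0 \<Longrightarrow> \<exists>v\<in>set (ray_chain k N (\<sigma>(x0 := 0)) xs). dot k v x > 0"
      using Suc.IH[of "insert x0 I" "\<sigma>(x0 := 0)" h'] by blast
    \<comment> \<open>As \<open>t\<close> is nonnegative, a strict sign of \<open>h\<close> at any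
      \<open>x\<close>, in \<open>N\<close> or not, is shared by \<open>h'\<close> or by
      \<open>v\<close>.\<close>
    have hd: "dot k h x = dot k h' x + t * dot k v x" for x by (simp add: h'd)
    have neg: "dot k h' x < 0 \<or> dot k v x < 0" if "dot k h x < 0" for x
      using that t0 unfolding hd by (smt (verit) mult_nonneg_nonneg)
    have pos: "dot k h' x > 0 \<or> dot k v x > 0" if "dot k h x > 0" for x
      using that t0 unfolding hd by (smt (verit) mult_nonneg_nonpos)
    have chain: "set (ray_chain k N \<sigma> (x0 # xs)) = insert v (set (ray_chain k N (\<sigma>(x0 := 0)) xs))"
      by (simp add: v_def)
    show ?thesis
    proof (intro exI[of _ "x0 # xs"] conjI allI impI)
      show "set (x0 # xs) \<subseteq> N" "length (x0 # xs) = Suc w"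
        using xs x0(1) by (auto simp: Y_def)
      show "\<exists>v\<in>set (ray_chain k N \<sigma> (x0 # xs)). dot k v x < 0" if "dot k h x < 0" for x
        using neg[OF that] xs(3)[of x] unfolding chain by blast
      show "\<exists>v\<in>set (ray_chain k N \<sigma> (x0 # xs)). dot k v x > 0" if "dot k h x > 0" for x
        using pos[OF that] xs(4)[of x] unfolding chain by blast
    qed
  qed
qed


section \<open>Containers\<close>

text \<open>Sampled points may repeat, so the elements of \<open>A\<close> first get distinct
  positions, which are then padded to exactly \<open>q\<close>.\<close>

lemma ex_index_set:
  assumes "A \<subseteq> s ` I" "finite I" "card A \<le> q" "q \<le> card I"
  shows "\<exists>J\<subseteq>I. card J = q \<and> A \<subseteq> s ` J"
proof -
  obtain J0 where J0: "J0 \<subseteq> I" "inj_on s J0" "A = s ` J0"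
    using assms(1) subset_image_inj by metis
  then have "card J0 \<le> q" using assms(3) card_image by metis
  then obtain J where "J0 \<subseteq> J" "J \<subseteq> I" "card J = q"
    using exists_subset_between[of J0 q I] J0(1) assms by blast
  then show ?thesis using J0 by blast
qed

text \<open>Union bound over the samples of size \<open>m\<close>, by counting: if a large set is missed by the sample, fix
  the \<open>q\<close> indices that determine it; the other \<open>m - q\<close> points then avoid a quarter of \<open>U\<close>.\<close>

lemma ex_hitting_sample:
  fixes U :: "'a set" and D :: "'a set \<Rightarrow> 'a set set"
  assumes U: "finite U" "U \<noteq> {}"
    and sub: "\<And>A. D A \<subseteq> Pow U"
    and mono: "\<And>A B. A \<subseteq> B \<Longrightarrow> D A \<subseteq> D B"
    and local: "\<And>A X. \<lbrakk>A \<subseteq> U; X \<in> D A\<rbrakk> \<Longrightarrow> \<exists>A'\<subseteq>A. card A' \<le> q \<and> X \<in> D A'"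
    and few: "\<And>A. \<lbrakk>finite A; card A \<le> q\<rbrakk> \<Longrightarrow> finite (D A) \<and> card (D A) \<le> M"
    and m: "m > 0" and q: "q \<le> m" and bound: "m ^ q * M * 3 ^ (m - q) < 4 ^ (m - q)"
  shows "\<exists>N\<subseteq>U. N \<noteq> {} \<and> card N \<le> m \<and> (\<forall>X\<in>D N. X \<inter> N = {} \<longrightarrow> 4 * card X \<le> card U)"
proof -
  define n where "n = card U"
  have n: "n > 0" using U by (simp add: n_def card_gt_0_iff)
  \<comment> \<open>Samples are ordered and allow repetition, so fixing the positions in
    \<open>J\<close> leaves the others free.\<close>
  define S where "S = {..<m} \<rightarrow>\<^sub>E U"
  define \<J> where "\<J> = {J. J \<subseteq> {..<m} \<and> card J = q}"
  define big where "big A = {X \<in> D A. n < 4 * card X}" for A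
  define Bad where "Bad J = {s \<in> S. \<exists>X\<in>big (s ` J). X \<inter> s ` {..<m} = {}}" for J
  have fS: "finite S" and cS: "card S = n ^ m"
    using U by (auto simp: S_def n_def card_funcsetE finite_PiE)
  have c\<J>: "finite \<J>" "card \<J> \<le> m ^ q"
    using n_subsets[of "{..<m}" q] binomial_le_pow[OF q] by (auto simp: \<J>_def)
  have bad: "4 ^ (m - q) * card (Bad J) \<le> n ^ q * (M * (3 * n) ^ (m - q))" if J: "J \<in> \<J>" for J
  proof -
    have J': "finite J" "card J = q" "J \<subseteq> {..<m}"
      using J by (auto simp: \<J>_def intro: finite_subset)
    then have cD: "card ({..<m} - J) = m - q"
      by (simp add: card_Diff_subset)
    have cJ: "finite (u ` J)" "card (u ` J) \<le> q" for u :: "nat \<Rightarrow> 'a"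
      using J' card_image_le by auto
    have fbig: "finite (big (u ` J))" "card (big (u ` J)) \<le> M" for u :: "nat \<Rightarrow> 'a"
      using few[OF cJ[of u]] card_mono[of "D (u ` J)" "big (u ` J)"] by (auto simp: big_def)
    \<comment> \<open>A bad sample is encoded by its values on \<open>J\<close>, a missed big set
      \<open>X\<close> available from those values, and its remaining values, all outside
      \<open>X\<close>.\<close>
    let ?P = "\<lambda>u. Sigma (big (u ` J)) (\<lambda>X. ({..<m} - J) \<rightarrow>\<^sub>E (U - X))"
    let ?Q = "Sigma (J \<rightarrow>\<^sub>E U) ?P"
    let ?f = "\<lambda>(u, X, t) i. if i \<in> J then u i else t i"
    have "Bad J \<subseteq> ?f ` ?Q"
    proof
      fix s assume "s \<in> Bad J"
      then obtain X where s: "s \<in> S" and X: "X \<in> big (s ` J)" "X \<inter> s ` {..<m} = {}"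
        by (auto simp: Bad_def)
      have "restrict s J ` J = s ` J" by auto
      then have "(restrict s J, X, restrict s ({..<m} - J)) \<in> ?Q"
        using s X J' by (auto simp: S_def PiE_def Pi_def extensional_def)
      moreover have "s = ?f (restrict s J, X, restrict s ({..<m} - J))"
        using s J' by (auto simp: S_def PiE_def extensional_def fun_eq_iff)
      ultimately show "s \<in> ?f ` ?Q" by blast
    qed
    moreover have fP: "finite (?P u)" for u
      using fbig U by (intro finite_SigmaI finite_PiE) auto
    moreover have fQ: "finite ?Q"
      using U J' by (intro finite_SigmaI[OF finite_PiE fP])
    ultimately have "card (Bad J) \<le> card ?Q"
      by (meson card_image_le card_mono finite_imageI order_trans)
    also have "\<dots> = (\<Sum>u\<in>J \<rightarrow>\<^sub>E U. card (?P u))"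
      using U J' fP by (intro card_SigmaI finite_PiE) auto
    finally have "4 ^ (m - q) * card (Bad J) \<le> (\<Sum>u\<in>J \<rightarrow>\<^sub>E U. 4 ^ (m - q) * card (?P u))"
      by (simp add: sum_distrib_left[symmetric])
    also have "\<dots> \<le> (\<Sum>u\<in>J \<rightarrow>\<^sub>E U. M * (3 * n) ^ (m - q))"
    proof (rule sum_mono)
      fix u
      have "card (?P u) = (\<Sum>X\<in>big (u ` J). card (({..<m} - J) \<rightarrow>\<^sub>E (U - X)))"
        using fbig U by (intro card_SigmaI) (auto intro: finite_PiE)
      also have "\<dots> = (\<Sum>X\<in>big (u ` J). card (U - X) ^ (m - q))"
        using cD by (simp add: card_funcsetE)
      finally have "4 ^ (m - q) * card (?P u) = (\<Sum>X\<in>big (u ` J). (4 * card (U - X)) ^ (m - q))"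
        by (simp add: sum_distrib_left power_mult_distrib)
      also have "\<dots> \<le> (\<Sum>X\<in>big (u ` J). (3 * n) ^ (m - q))"
      proof (intro sum_mono power_mono)
        fix X assume X: "X \<in> big (u ` J)"
        then have "X \<subseteq> U" using sub by (auto simp: big_def)
        then have "card (U - X) = n - card X" "card X \<le> n"
          using U(1) finite_subset[of X U] by (auto simp: n_def card_Diff_subset card_mono)
        then show "4 * card (U - X) \<le> 3 * n" using X by (auto simp: big_def)
      qed simp
      also have "\<dots> \<le> M * (3 * n) ^ (m - q)" using fbig by simp
      finally show "4 ^ (m - q) * card (?P u) \<le> M * (3 * n) ^ (m - q)" .
    qed
    also have "\<dots> = n ^ q * (M * (3 * n) ^ (m - q))"
      using J' by (simp add: card_funcsetE n_def)
    finally show ?thesis .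
  qed
  \<comment> \<open>If all samples were bad, summing over the at most \<open>m ^ q\<close> index
    sets would contradict \<open>bound\<close>.\<close>
  have "\<exists>s\<in>S. s \<notin> (\<Union>J\<in>\<J>. Bad J)"
  proof (rule ccontr)
    assume "\<not> ?thesis"
    then have sub': "S \<subseteq> (\<Union>J\<in>\<J>. Bad J)" by blast
    have fB: "finite (Bad J)" for J unfolding Bad_def using fS by simp
    have "n ^ m \<le> card (\<Union>J\<in>\<J>. Bad J)"
      unfolding cS[symmetric] using c\<J>(1) fB by (intro card_mono sub') auto
    also have "\<dots> \<le> (\<Sum>J\<in>\<J>. card (Bad J))" using c\<J>(1) by (rule card_UN_le)
    finally have "4 ^ (m - q) * n ^ m \<le> (\<Sum>J\<in>\<J>. 4 ^ (m - q) * card (Bad J))"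
      by (simp add: sum_distrib_left[symmetric])
    also have "\<dots> \<le> (\<Sum>J\<in>\<J>. n ^ q * (M * (3 * n) ^ (m - q)))"
      using bad by (rule sum_mono)
    also have "\<dots> \<le> m ^ q * (n ^ q * (M * (3 * n) ^ (m - q)))"
      using c\<J>(2) by (simp add: mult_le_mono1)
    also have "\<dots> = (m ^ q * M * 3 ^ (m - q)) * (n ^ q * n ^ (m - q))"
      by (simp add: power_mult_distrib algebra_simps)
    also have "n ^ q * n ^ (m - q) = n ^ m" using q by (simp add: power_add[symmetric])
    also have "(m ^ q * M * 3 ^ (m - q)) * n ^ m < 4 ^ (m - q) * n ^ m"
      using bound n by simp
    finally show False by simp
  qed
  then obtain s where s: "s \<in> S" "\<And>J. J \<in> \<J> \<Longrightarrow> s \<notin> Bad J" by blast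
  let ?N = "s ` {..<m}"
  have N: "?N \<subseteq> U" using s(1) by (auto simp: S_def)
  have "4 * card X \<le> card U" if X: "X \<in> D ?N" "X \<inter> ?N = {}" for X
  proof (rule ccontr)
    assume big: "\<not> 4 * card X \<le> card U"
    \<comment> \<open>The few points that determine \<open>X\<close> occupy positions in some
      \<open>J\<close>; by monotonicity \<open>X\<close> is available from all of \<open>J\<close>,
      so \<open>s\<close> is bad for \<open>J\<close>.\<close>
    obtain A where A: "A \<subseteq> ?N" "card A \<le> q" "X \<in> D A" using local[OF N X(1)] by blast
    obtain J where J: "J \<subseteq> {..<m}" "card J = q" "A \<subseteq> s ` J"
      using ex_index_set[OF A(1) _ A(2)] q by auto
    then have "X \<in> big (s ` J)" using A(3) mono[OF J(3)] big by (auto simp: big_def n_def)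
    then have "s \<in> Bad J" using s(1) X(2) by (auto simp: Bad_def)
    then show False using s(2)[of J] J by (simp add: \<J>_def)
  qed
  moreover have "card ?N \<le> m" using card_image_le[of "{..<m}" s] by simp
  ultimately show ?thesis using N m by (intro exI[of _ ?N]) auto
qed

section \<open>Sampling hyperplanes\<close>

definition crossed :: "nat \<Rightarrow> ('a \<Rightarrow> nat \<Rightarrow> real) \<Rightarrow> 'a set \<Rightarrow> (nat \<Rightarrow> real) set \<Rightarrow> 'a set" where
  "crossed k \<phi> U V =
     {x \<in> U. (\<exists>v\<in>V. dot k v (\<phi> x) < 0) \<and> (\<exists>v\<in>V. dot k v (\<phi> x) > 0)}"

text \<open>The factors other than the powers of 3 and 4 amount to at most
  \<open>2 ^ (13 * k ^ 3)\<close>. Three surplus points gain a factor 64/27 > 2, and at least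
  \<open>63 * k ^ 3\<close> points are surplus, which outweighs even
  \<open>2 ^ (21 * k ^ 3)\<close>.\<close>

lemma sample_size_bound:
  fixes k :: nat
  assumes "k \<ge> 1"
  defines "m \<equiv> 64 * k ^ 3" and "q \<equiv> k * k"
  shows "q \<le> m" "m ^ q * (2 ^ (q + k + 2)) ^ k * 3 ^ (m - q) < (4::nat) ^ (m - q)"
proof -
  have k3: "k ^ 3 = k * (k * k)" by (simp add: power3_eq_cube)
  have le1: "k * k \<le> k ^ 3" using assms(1) unfolding k3 by simp
  then show qm: "q \<le> m" by (simp add: m_def q_def)
  have le2: "k \<le> k ^ 3" using le1 assms(1) le_square order_trans by blast
  have "m \<le> 2 ^ 6 * (2 ^ k) ^ 3"
    unfolding m_def by (intro mult_mono power_mono) (auto intro: less_imp_le less_exp)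
  also have "\<dots> = (2::nat) ^ (6 + 3 * k)" by (simp add: power_add power_mult[symmetric] mult.commute)
  finally have "m ^ q \<le> (2 ^ (6 + 3 * k)) ^ q" by (rule power_mono) simp
  then have "m ^ q * (2 ^ (q + k + 2)) ^ k \<le> (2 ^ (6 + 3 * k)) ^ q * (2 ^ (q + k + 2)) ^ k"
    by (rule mult_right_mono) simp
  also have "\<dots> = (2::nat) ^ ((6 + 3 * k) * q + (q + k + 2) * k)"
    by (simp only: power_add power_mult)
  also have "\<dots> \<le> 2 ^ (13 * k ^ 3)"
  proof (rule power_increasing)
    have "(6 + 3 * k) * q + (q + k + 2) * k = 6 * (k * k) + 3 * k ^ 3 + (k ^ 3 + k * k + 2 * k)"
      by (simp add: q_def k3 algebra_simps)
    then show "(6 + 3 * k) * q + (q + k + 2) * k \<le> 13 * k ^ 3" using le1 le2 by linarith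
  qed simp
  also have "\<dots> < (2::nat) ^ (21 * k ^ 3)"
    using assms(1) by (intro power_strict_increasing) auto
  finally have A: "m ^ q * (2 ^ (q + k + 2)) ^ k < (2::nat) ^ (21 * k ^ 3)" .
  obtain r where r: "m - q = 3 * (21 * k ^ 3) + r"
  proof -
    have "63 * k ^ 3 \<le> m - q" using le1 by (simp add: m_def q_def)
    then show ?thesis using that le_Suc_ex by fastforce
  qed
  have "2 ^ (21 * k ^ 3) * 3 ^ (3 * (21 * k ^ 3)) = (2 * 27 :: nat) ^ (21 * k ^ 3)"
    by (simp add: power_mult power_mult_distrib[symmetric])
  also have "\<dots> \<le> 64 ^ (21 * k ^ 3)" by (rule power_mono) auto
  also have "\<dots> = 4 ^ (3 * (21 * k ^ 3))" by (simp add: power_mult)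
  finally have "2 ^ (21 * k ^ 3) * 3 ^ (3 * (21 * k ^ 3)) * 3 ^ r \<le> (4::nat) ^ (3 * (21 * k ^ 3)) * 4 ^ r"
    by (intro mult_mono power_mono) auto
  then have "2 ^ (21 * k ^ 3) * 3 ^ (m - q) \<le> (4::nat) ^ (m - q)"
    unfolding r by (simp only: power_add mult.assoc)
  moreover have "m ^ q * (2 ^ (q + k + 2)) ^ k * 3 ^ (m - q) < (2::nat) ^ (21 * k ^ 3) * 3 ^ (m - q)"
    using A by (intro mult_strict_right_mono) auto
  ultimately show "m ^ q * (2 ^ (q + k + 2)) ^ k * 3 ^ (m - q) < (4::nat) ^ (m - q)" by linarith
qed

text \<open>Each ray is fixed by at most \<open>k\<close> constraints and the zero vector by none.
  Those in \<open>B\<close> are always present, so only points of \<open>A\<close> are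
  counted.\<close>

lemma generators_local:
  assumes "set vs \<subseteq> generators k (\<phi> ` A \<union> B)"
  shows "\<exists>A'\<subseteq>A. finite A' \<and> card A' \<le> k * length vs \<and> set vs \<subseteq> generators k (\<phi> ` A' \<union> B)"
  using assms
proof (induction vs)
  case Nil
  then show ?case by (intro exI[of _ "{}"]) auto
next
  case (Cons v vs)
  then obtain A1 where A1: "A1 \<subseteq> A" "finite A1" "card A1 \<le> k * length vs"
    "set vs \<subseteq> generators k (\<phi> ` A1 \<union> B)" by auto
  have "\<exists>A2\<subseteq>A. finite A2 \<and> card A2 \<le> k \<and> v \<in> generators k (\<phi> ` A2 \<union> B)"
  proof (cases "v = (\<lambda>i. 0)")
    case True
    then show ?thesis by (intro exI[of _ "{}"]) (auto simp: generators_def)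
  next
    case False
    moreover have "v \<in> generators k (\<phi> ` A \<union> B)" using Cons.prems by simp
    ultimately have "v \<in> (\<Union>T\<in>{T. T \<subseteq> \<phi> ` A \<union> B \<and> finite T \<and> card T \<le> k}. rays k T)"
      unfolding generators_def by (simp only: insert_iff simp_thms)
    then obtain T where T: "T \<subseteq> \<phi> ` A \<union> B" "finite T" "card T \<le> k" "v \<in> rays k T"
      by blast
    \<comment> \<open>An injective choice of preimages, so that the bound on \<open>T\<close>
      carries over to points of \<open>A\<close>.\<close>
    obtain A2 where A2: "A2 \<subseteq> A" "inj_on \<phi> A2" "T \<inter> \<phi> ` A = \<phi> ` A2"
      using subset_image_inj[of "T \<inter> \<phi> ` A" \<phi> A] by auto
    have fin: "finite (\<phi> ` A2)" using T(2) A2(3) by (metis finite_Int)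
    have "card A2 = card (T \<inter> \<phi> ` A)" using A2 card_image by metis
    also have "\<dots> \<le> k" using T(2,3) card_mono[of T "T \<inter> \<phi> ` A"] by auto
    finally have "card A2 \<le> k" .
    moreover have "finite A2" using fin A2(2) finite_imageD by blast
    moreover have "T \<subseteq> \<phi> ` A2 \<union> B" using T(1) A2(3) by blast
    moreover have "v \<in> generators k (\<phi> ` A2 \<union> B)"
      unfolding generators_def by (rule insertI2, rule UN_I[of T]) (use calculation T in auto)
    ultimately show ?thesis using A2(1) by (intro exI[of _ A2]) simp
  qed
  then obtain A2 where A2: "A2 \<subseteq> A" "finite A2" "card A2 \<le> k" "v \<in> generators k (\<phi> ` A2 \<union> B)"
    by blast
  have "card (A1 \<union> A2) \<le> k * length (v # vs)"
    using card_Un_le[of A1 A2] A1(3) A2(3) by simp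
  moreover have "generators k (\<phi> ` A1 \<union> B) \<subseteq> generators k (\<phi> ` (A1 \<union> A2) \<union> B)"
    "generators k (\<phi> ` A2 \<union> B) \<subseteq> generators k (\<phi> ` (A1 \<union> A2) \<union> B)"
    by (intro generators_mono; blast)+
  then have "set (v # vs) \<subseteq> generators k (\<phi> ` (A1 \<union> A2) \<union> B)"
    using A1(4) A2(4) unfolding list.set insert_subset by blast
  ultimately show ?case using A1(1,2) A2(1,2) by (intro exI[of _ "A1 \<union> A2"] conjI) simp_all
qed

text \<open>The hitting sample for the sets crossed by \<open>k\<close> generators: these depend on
  \<open>k * k\<close> sampled points, and \<open>k * k + k\<close> constraints bound the number of
  generator lists.\<close>

lemma ex_crossing_sample:
  fixes \<phi> :: "'a \<Rightarrow> nat \<Rightarrow> real"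
  assumes U: "finite U" "U \<noteq> {}" and k: "k \<ge> 1"
  shows "\<exists>N\<subseteq>U. N \<noteq> {} \<and> card N \<le> 64 * k ^ 3 \<and>
    (\<forall>vs. set vs \<subseteq> generators k (\<phi> ` N \<union> std_basis k) \<and> length vs = k \<and>
      crossed k \<phi> U (set vs) \<inter> N = {} \<longrightarrow> 4 * card (crossed k \<phi> U (set vs)) \<le> card U)"
proof -
  let ?G = "\<lambda>A. generators k (\<phi> ` A \<union> std_basis k)"
  let ?L = "\<lambda>A. {vs. set vs \<subseteq> ?G A \<and> length vs = k}"
  define D where "D A = (\<lambda>vs. crossed k \<phi> U (set vs)) ` ?L A" for A
  have "\<exists>N\<subseteq>U. N \<noteq> {} \<and> card N \<le> 64 * k ^ 3 \<and> (\<forall>X\<in>D N. X \<inter> N = {} \<longrightarrow> 4 * card X \<le> card U)"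
  proof (rule ex_hitting_sample[OF U, where q = "k * k" and M = "(2 ^ (k * k + k + 2)) ^ k"])
    show "D A \<subseteq> Pow U" for A by (auto simp: D_def crossed_def)
    show "D A \<subseteq> D B" if "A \<subseteq> B" for A B
    proof -
      have "?G A \<subseteq> ?G B" using that by (intro generators_mono) blast
      then have "?L A \<subseteq> ?L B" by auto
      then show ?thesis unfolding D_def by (rule image_mono)
    qed
    show "\<exists>A'\<subseteq>A. card A' \<le> k * k \<and> X \<in> D A'" if "A \<subseteq> U" "X \<in> D A" for A X
    proof -
      obtain vs where vs: "X = crossed k \<phi> U (set vs)" "set vs \<subseteq> ?G A" "length vs = k"
        using \<open>X \<in> D A\<close> by (auto simp: D_def)
      then obtain A' where A': "A' \<subseteq> A" "card A' \<le> k * k" "set vs \<subseteq> ?G A'"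
        using generators_local[of vs k \<phi> A "std_basis k"] by auto
      moreover from this have "X \<in> D A'"
        unfolding D_def vs(1) using vs(3) by (intro imageI) simp
      ultimately show ?thesis by blast
    qed
    show "finite (D A) \<and> card (D A) \<le> (2 ^ (k * k + k + 2)) ^ k" if A: "finite A" "card A \<le> k * k" for A
    proof -
      let ?N = "\<phi> ` A \<union> std_basis k"
      have "card ?N \<le> card (\<phi> ` A) + card (std_basis k)" by (rule card_Un_le)
      also have "\<dots> \<le> k * k + k"
        by (intro add_mono card_std_basis_le order_trans[OF card_image_le[OF A(1)] A(2)])
      finally have "card ?N \<le> k * k + k" .
      then have "(2::nat) ^ (card ?N + 2) \<le> 2 ^ (k * k + k + 2)"
        by (intro power_increasing) auto
      moreover have G: "finite (?G A)" "card (?G A) \<le> 2 ^ (card ?N + 2)"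
        using card_generators[of ?N k] A(1) by auto
      ultimately have "card (?G A) \<le> 2 ^ (k * k + k + 2)" by linarith
      then have "card (?L A) \<le> (2 ^ (k * k + k + 2)) ^ k"
        unfolding card_lists_length_eq[OF G(1)] by (rule power_mono) simp
      moreover have "finite (?L A)" using finite_lists_length_eq[OF G(1)] .
      ultimately show ?thesis
        unfolding D_def using card_image_le[of "?L A" "\<lambda>vs. crossed k \<phi> U (set vs)"] by simp
    qed
    show "64 * k ^ 3 > 0" using k by simp
    show "k * k \<le> 64 * k ^ 3" "(64 * k ^ 3) ^ (k * k) * (2 ^ (k * k + k + 2)) ^ k * 3 ^ (64 * k ^ 3 - k * k)
        < 4 ^ (64 * k ^ 3 - k * k)"
      using sample_size_bound[OF k] by auto
  qed
  then obtain N where N: "N \<subseteq> U" "N \<noteq> {}" "card N \<le> 64 * k ^ 3"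
    "\<And>X. X \<in> D N \<Longrightarrow> X \<inter> N = {} \<Longrightarrow> 4 * card X \<le> card U" by blast
  have "4 * card (crossed k \<phi> U (set vs)) \<le> card U"
    if "set vs \<subseteq> ?G N \<and> length vs = k \<and> crossed k \<phi> U (set vs) \<inter> N = {}" for vs
    using that by (intro N(4)) (simp_all add: D_def)
  then show ?thesis using N(1-3) by (intro exI[of _ N]) simp
qed

section \<open>Containers from ray chains\<close>

text \<open>Only negative sides are contained; a positive side is the negative side of
  \<open>-h\<close>.\<close>

definition container_family ::
  "nat \<Rightarrow> ('a \<Rightarrow> nat \<Rightarrow> real) \<Rightarrow> 'a set \<Rightarrow> 'a set set \<Rightarrow> bool" where
  "container_family k \<phi> U \<C> \<longleftrightarrow>
     (\<forall>h\<in>coord_space k. (\<forall>x\<in>U. dot k h (\<phi> x) \<noteq> 0) \<longrightarrow>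
       (\<exists>C\<in>\<C>. {x \<in> U. dot k h (\<phi> x) < 0} \<subseteq> C \<and> C \<subseteq> U \<and>
         4 * card (C - {x \<in> U. dot k h (\<phi> x) < 0}) \<le> card U))"

text \<open>A container collects the points at which some ray of a chain is negative. If the chain
  covers \<open>h\<close>, it holds the negative side of \<open>h\<close>, and at an excess point
  \<open>h\<close> is positive, so some ray is too and the point is crossed. Sampled points are not
  crossed, as the rays share a cell, so the excess is at most a quarter. The count multiplies cells
  by lists of \<open>k\<close> facets.\<close>

lemma ex_container_family:
  fixes \<phi> :: "'a \<Rightarrow> nat \<Rightarrow> real"
  assumes U: "finite U" "U \<noteq> {}" and \<phi>: "\<phi> ` U \<subseteq> coord_space k" and k: "k \<ge> 1"
  shows "\<exists>\<C>. finite \<C> \<and> container_family k \<phi> U \<C> \<and>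
    card \<C> \<le> ((2 * (64 * k ^ 3 + k) + 1) * (64 * k ^ 3 + k)) ^ k"
proof -
  obtain S where S: "S \<subseteq> U" "S \<noteq> {}" "card S \<le> 64 * k ^ 3"
    and cross: "\<And>vs. \<lbrakk>set vs \<subseteq> generators k (\<phi> ` S \<union> std_basis k); length vs = k;
      crossed k \<phi> U (set vs) \<inter> S = {}\<rbrakk> \<Longrightarrow> 4 * card (crossed k \<phi> U (set vs)) \<le> card U"
    using ex_crossing_sample[OF U k, of \<phi>] by blast
  define N where "N = \<phi> ` S \<union> std_basis k"
  have fS: "finite S" using S(1) U(1) finite_subset by blast
  have N: "finite N" "std_basis k \<subseteq> N" "N \<subseteq> coord_space k" "N \<noteq> {}"
    using fS S \<phi> std_basis_subset[of k] by (auto simp: N_def)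
  have "card N \<le> card (\<phi> ` S) + card (std_basis k)" unfolding N_def by (rule card_Un_le)
  also have "\<dots> \<le> 64 * k ^ 3 + k"
    by (intro add_mono card_std_basis_le order_trans[OF card_image_le[OF fS] S(3)])
  finally have cN: "card N \<le> 64 * k ^ 3 + k" .
  let ?\<Sigma> = "sign_vectors k N {}" and ?X = "{xs. set xs \<subseteq> N \<and> length xs = k}"
  define cont where "cont = (\<lambda>(\<sigma>, xs). {x \<in> U. \<exists>v\<in>set (ray_chain k N \<sigma> xs). dot k v (\<phi> x) < 0})"
  define \<C> where "\<C> = cont ` (?\<Sigma> \<times> ?X)"
  have "fun_space.independent {}" by (rule fun_space.independent_empty)
  then have \<Sigma>: "finite ?\<Sigma>" "card ?\<Sigma> \<le> (2 * card N + 1) ^ k"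
    using card_sign_vectors[OF N(1,3), of "{}" k] by auto
  have X: "finite ?X" "card ?X = card N ^ k"
    using N(1) finite_lists_length_eq card_lists_length_eq by blast+
  have "card \<C> \<le> card (?\<Sigma> \<times> ?X)"
    unfolding \<C>_def using \<Sigma> X by (intro card_image_le) auto
  also have "\<dots> \<le> (2 * card N + 1) ^ k * card N ^ k"
    using \<Sigma> X by (simp add: card_cartesian_product)
  also have "\<dots> = ((2 * card N + 1) * card N) ^ k" by (simp only: power_mult_distrib)
  also have "\<dots> \<le> ((2 * (64 * k ^ 3 + k) + 1) * (64 * k ^ 3 + k)) ^ k"
    using cN by (intro power_mono mult_mono) auto
  finally have c: "card \<C> \<le> ((2 * (64 * k ^ 3 + k) + 1) * (64 * k ^ 3 + k)) ^ k" .
  have "\<exists>C\<in>\<C>. {x \<in> U. dot k h (\<phi> x) < 0} \<subseteq> C \<and> C \<subseteq> U \<and>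
      4 * card (C - {x \<in> U. dot k h (\<phi> x) < 0}) \<le> card U"
    if h: "h \<in> coord_space k" "\<forall>x\<in>U. dot k h (\<phi> x) \<noteq> 0" for h
  proof -
    define \<sigma> where "\<sigma> = restrict (\<lambda>x. sgn (dot k h x)) N"
    have \<sigma>: "\<sigma> \<in> ?\<Sigma>" using h(1) by (auto simp: \<sigma>_def sign_vectors_def)
    have cell: "h \<in> cell k N \<sigma>" using h(1) by (auto simp: cell_def \<sigma>_def)
    obtain xs where xs: "set xs \<subseteq> N" "length xs = k"
      "\<And>x. dot k h x < 0 \<Longrightarrow> \<exists>v\<in>set (ray_chain k N \<sigma> xs). dot k v x < 0"
      "\<And>x. dot k h x > 0 \<Longrightarrow> \<exists>v\<in>set (ray_chain k N \<sigma> xs). dot k v x > 0"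
      using ex_ray_chain[OF N fun_space.independent_empty _ _ _ cell, of k] by auto
    let ?vs = "ray_chain k N \<sigma> xs" and ?C = "cont (\<sigma>, xs)" and ?H = "{x \<in> U. dot k h (\<phi> x) < 0}"
    have vs: "set ?vs \<subseteq> generators k N" "set ?vs \<subseteq> cell k N \<sigma>"
      using ray_chain_subset[OF N(1-3), of \<sigma> xs] by auto
    have "crossed k \<phi> U (set ?vs) \<inter> S = {}"
    proof -
      have False if "x \<in> S" "v \<in> set ?vs" "w \<in> set ?vs" "dot k v (\<phi> x) < 0" "dot k w (\<phi> x) > 0" for x v w
      proof -
        have "\<phi> x \<in> N" using that(1) by (simp add: N_def)
        then have "sgn (dot k v (\<phi> x)) = \<sigma> (\<phi> x)" "sgn (dot k w (\<phi> x)) = \<sigma> (\<phi> x)"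
          using subsetD[OF vs(2) that(2)] subsetD[OF vs(2) that(3)] that(4,5) by (force simp: cell_def)+
        then show False using that(4,5) by auto
      qed
      then show ?thesis by (auto simp: crossed_def)
    qed
    then have le: "4 * card (crossed k \<phi> U (set ?vs)) \<le> card U"
      using vs(1) xs(2) by (intro cross) (auto simp: N_def)
    have "?C - ?H \<subseteq> crossed k \<phi> U (set ?vs)"
    proof
      fix x assume x: "x \<in> ?C - ?H"
      then have "dot k h (\<phi> x) > 0" using h(2) by (force simp: cont_def)
      then show "x \<in> crossed k \<phi> U (set ?vs)"
        using x xs(4) by (auto simp: crossed_def cont_def)
    qed
    moreover have "finite (crossed k \<phi> U (set ?vs))" using U(1) by (simp add: crossed_def)
    ultimately have "card (?C - ?H) \<le> card (crossed k \<phi> U (set ?vs))" by (rule card_mono[rotated])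
    moreover have "?H \<subseteq> ?C" "?C \<subseteq> U" using xs(3) by (auto simp: cont_def)
    moreover have "?C \<in> \<C>" using \<sigma> xs(1,2) unfolding \<C>_def by blast
    ultimately show ?thesis using le by (intro bexI[of _ ?C]) auto
  qed
  then have "container_family k \<phi> U \<C>" by (simp add: container_family_def)
  moreover have "finite \<C>" unfolding \<C>_def using \<Sigma> X by simp
  ultimately show ?thesis using c by blast
qed


section \<open>Protocols\<close>

text \<open>Both players know the output of the first protocol, so the continuation may depend on
  it.\<close>

primrec bind_protocol ::
  "('a, 'b, 'o) protocol \<Rightarrow> ('o \<Rightarrow> ('a, 'b, 'p) protocol) \<Rightarrow> ('a, 'b, 'p) protocol" where
  "bind_protocol (Output z) K = K z"
| "bind_protocol (Alice g P Q) K = Alice g (bind_protocol P K) (bind_protocol Q K)"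
| "bind_protocol (Bob g P Q) K = Bob g (bind_protocol P K) (bind_protocol Q K)"

lemma run_bind [simp]: "run (bind_protocol P K) a b = run (K (run P a b)) a b"
  by (induction P) auto

lemma bits_bind [simp]:
  "bits_exchanged (bind_protocol P K) a b = bits_exchanged P a b + bits_exchanged (K (run P a b)) a b"
  by (induction P) auto

text \<open>The sender becomes a parameter, \<open>True\<close> for Alice, so one argument serves
  all assignments of roles.\<close>

definition ask :: "bool \<Rightarrow> ('a \<Rightarrow> bool) \<Rightarrow> ('a, 'a, 'o) protocol \<Rightarrow> ('a, 'a, 'o) protocol \<Rightarrow> ('a, 'a, 'o) protocol" where
  "ask p g P Q = (if p then Alice g P Q else Bob g P Q)"

abbreviation owned :: "bool \<Rightarrow> 'a \<Rightarrow> 'a \<Rightarrow> 'a" where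
  "owned p a b \<equiv> if p then a else b"

lemma run_ask: "run (ask p g P Q) a b = (if g (owned p a b) then run P a b else run Q a b)"
  by (simp add: ask_def)

lemma bits_ask: "bits_exchanged (ask p g P Q) a b =
  Suc (if g (owned p a b) then bits_exchanged P a b else bits_exchanged Q a b)"
  by (simp add: ask_def)

text \<open>Each bit tells in which half of the remaining candidates the value lies. For a value
  outside \<open>S\<close> only the bit bound is claimed.\<close>

lemma ex_send_protocol:
  fixes g :: "'a \<Rightarrow> 'c" and K :: "'c \<Rightarrow> ('a, 'a, 'o) protocol"
  assumes "finite S" "card S \<le> 2 ^ B" "\<And>c a b. c \<in> S \<Longrightarrow> bits_exchanged (K c) a b \<le> D"
  shows "\<exists>Q. (\<forall>a b. bits_exchanged Q a b \<le> B + D) \<and>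
    (\<forall>a b. g (owned p a b) \<in> S \<longrightarrow> run Q a b = run (K (g (owned p a b))) a b)"
  using assms
proof (induction B arbitrary: S)
  case 0
  show ?case
  proof (cases "S = {}")
    case True
    then show ?thesis by (intro exI[of _ "Output undefined"]) simp
  next
    case False
    then have "card S = 1" using 0 by (simp add: le_Suc_eq)
    then obtain c where "S = {c}" by (auto simp: card_1_singleton_iff)
    then show ?thesis using 0 by (intro exI[of _ "K c"]) auto
  qed
next
  case (Suc B)
  obtain S1 where S1: "S1 \<subseteq> S" "card S1 = min (card S) (2 ^ B)"
    using obtain_subset_with_card_n[of "min (card S) (2 ^ B)" S] by auto
  have f: "finite S1" "finite (S - S1)" using S1 Suc.prems(1) finite_subset by auto
  have "card (S - S1) = card S - card S1" using f S1 by (simp add: card_Diff_subset)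
  then have c: "card S1 \<le> 2 ^ B" "card (S - S1) \<le> 2 ^ B" using S1 Suc.prems(2) by auto
  have "\<And>c a b. c \<in> S1 \<Longrightarrow> bits_exchanged (K c) a b \<le> D" using Suc.prems(3) S1(1) by auto
  from Suc.IH[OF f(1) c(1) this] obtain Q1 where Q1: "\<And>a b. bits_exchanged Q1 a b \<le> B + D"
    "\<And>a b. g (owned p a b) \<in> S1 \<Longrightarrow> run Q1 a b = run (K (g (owned p a b))) a b" by blast
  have "\<And>c a b. c \<in> S - S1 \<Longrightarrow> bits_exchanged (K c) a b \<le> D" using Suc.prems(3) by auto
  from Suc.IH[OF f(2) c(2) this] obtain Q2 where Q2: "\<And>a b. bits_exchanged Q2 a b \<le> B + D"
    "\<And>a b. g (owned p a b) \<in> S - S1 \<Longrightarrow> run Q2 a b = run (K (g (owned p a b))) a b" by blast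
  show ?case
  proof (intro exI[of _ "ask p (\<lambda>i. g i \<in> S1) Q1 Q2"] conjI allI impI)
    show "bits_exchanged (ask p (\<lambda>i. g i \<in> S1) Q1 Q2) a b \<le> Suc B + D" for a b
      using Q1(1)[of a b] Q2(1)[of a b] by (simp add: bits_ask)
    show "run (ask p (\<lambda>i. g i \<in> S1) Q1 Q2) a b = run (K (g (owned p a b))) a b"
      if "g (owned p a b) \<in> S" for a b
      unfolding run_ask using Q1(2)[of a b] Q2(2)[of a b] that by (cases "g (owned p a b) \<in> S1") auto
  qed
qed

section \<open>Shrinking the domain round by round\<close>

text \<open>The functional is nonzero on all of \<open>U\<close>, not just on the samples, because
  containers are provided only for such functionals.\<close>

definition separated ::
  "nat \<Rightarrow> ('x \<Rightarrow> nat \<Rightarrow> real) \<Rightarrow> 'x set \<Rightarrow> 'x set \<Rightarrow> 'x set \<Rightarrow> bool" where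
  "separated k \<phi> U X Y \<longleftrightarrow> (\<exists>h\<in>coord_space k. \<forall>x\<in>U. dot k h (\<phi> x) \<noteq> 0 \<and>
     (x \<in> X \<longrightarrow> dot k h (\<phi> x) < 0) \<and> (x \<in> Y \<longrightarrow> dot k h (\<phi> x) > 0))"

lemma separated_subset: "\<lbrakk>separated k \<phi> U X Y; C \<subseteq> U\<rbrakk> \<Longrightarrow> separated k \<phi> C X Y"
  unfolding separated_def by blast

text \<open>A separating hyperplane leaves at most half of the points on one side, so one of the players
  sees a container of at most three quarters of the points that holds all of that player's sample.\<close>

lemma ex_shrinking_container:
  fixes \<phi> :: "'x \<Rightarrow> nat \<Rightarrow> real"
  assumes U: "finite U" and cont: "container_family k \<phi> U \<C>" and sep: "separated k \<phi> U X Y"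
  shows "\<exists>C\<in>\<C>. C \<subseteq> U \<and> 4 * card C \<le> 3 * card U \<and> (X \<inter> U \<subseteq> C \<or> Y \<inter> U \<subseteq> C)"
proof -
  have small: "\<exists>C\<in>\<C>. C \<subseteq> U \<and> 4 * card C \<le> 3 * card U \<and> {x \<in> U. dot k h (\<phi> x) < 0} \<subseteq> C"
    if h: "h \<in> coord_space k" "\<forall>x\<in>U. dot k h (\<phi> x) \<noteq> 0"
      and half: "2 * card {x \<in> U. dot k h (\<phi> x) < 0} \<le> card U" for h
  proof -
    let ?H = "{x \<in> U. dot k h (\<phi> x) < 0}"
    obtain C where C: "C \<in> \<C>" "?H \<subseteq> C" "C \<subseteq> U" "4 * card (C - ?H) \<le> card U"
      using bspec[OF cont[unfolded container_family_def] h(1)] h(2) by blast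
    have "finite ?H" using U by simp
    then have "card (C - ?H) = card C - card ?H" using C(2) by (rule card_Diff_subset)
    then have "4 * card C \<le> 3 * card U" using C(4) half by linarith
    then show ?thesis using C(1-3) by (intro bexI[of _ C] conjI)
  qed
  obtain h where h: "h \<in> coord_space k" "\<forall>x\<in>U. dot k h (\<phi> x) \<noteq> 0"
    "\<forall>x\<in>U. x \<in> X \<longrightarrow> dot k h (\<phi> x) < 0" "\<forall>x\<in>U. x \<in> Y \<longrightarrow> dot k h (\<phi> x) > 0"
    using sep unfolding separated_def ball_conj_distrib by (elim bexE conjE)
  \<comment> \<open>Negation turns the positive side into a negative one, so the same family serves
    both players.\<close>
  let ?g = "\<lambda>i. - h i"
  have g: "?g \<in> coord_space k" "\<forall>x\<in>U. dot k ?g (\<phi> x) \<noteq> 0"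
    using h(1,2) by (simp_all add: coord_space_def)
  let ?N = "{x \<in> U. dot k h (\<phi> x) < 0}" and ?P = "{x \<in> U. dot k ?g (\<phi> x) < 0}"
  have XN: "X \<inter> U \<subseteq> ?N" and YP: "Y \<inter> U \<subseteq> ?P"
    using h(3,4) by (simp_all add: subset_iff)
  have "card (?N \<union> ?P) = card ?N + card ?P" using U by (intro card_Un_disjoint) auto
  moreover have "card (?N \<union> ?P) \<le> card U" using U by (intro card_mono) auto
  ultimately consider "2 * card ?N \<le> card U" | "2 * card ?P \<le> card U" by linarith
  then show ?thesis
  proof cases
    case 1
    from small[OF h(1,2) this] obtain C
      where C: "C \<in> \<C>" "C \<subseteq> U" "4 * card C \<le> 3 * card U" "?N \<subseteq> C" by (elim bexE conjE)
    have "X \<inter> U \<subseteq> C" using XN C(4) by (rule subset_trans)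
    then show ?thesis using C(1-3) by (intro bexI[of _ C] conjI disjI1)
  next
    case 2
    from small[OF g this] obtain C
      where C: "C \<in> \<C>" "C \<subseteq> U" "4 * card C \<le> 3 * card U" "?P \<subseteq> C" by (elim bexE conjE)
    have "Y \<inter> U \<subseteq> C" using YP C(4) by (rule subset_trans)
    then show ?thesis using C(1-3) by (intro bexI[of _ C] conjI disjI2)
  qed
qed

text \<open>A round costs one bit for who speaks and \<open>B\<close> bits for the container, and
  leaves at most 3/4 of the domain; after \<open>r\<close> rounds less than one point
  remains.\<close>

lemma ex_one_sided_protocol:
  fixes \<phi> :: "'x \<Rightarrow> nat \<Rightarrow> real" and X Y :: "'i \<Rightarrow> 'x set"
  assumes k: "k \<ge> 1" and B: "((2 * (64 * k ^ 3 + k) + 1) * (64 * k ^ 3 + k)) ^ k \<le> 2 ^ B"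
    and "finite U" "\<phi> ` U \<subseteq> coord_space k" "3 ^ r * card U < 4 ^ r"
  shows "\<exists>P :: ('i, 'i, 'x \<Rightarrow> bool) protocol. (\<forall>a b. bits_exchanged P a b \<le> r * (B + 1)) \<and>
    (\<forall>a b. separated k \<phi> U (X (owned p a b)) (Y (owned q a b)) \<longrightarrow>
      (\<forall>x\<in>U. (x \<in> X (owned p a b) \<longrightarrow> run P a b x) \<and> (x \<in> Y (owned q a b) \<longrightarrow> \<not> run P a b x)))"
  using assms(3-)
proof (induction r arbitrary: U)
  case 0
  then have "U = {}" by simp
  then show ?case by (intro exI[of _ "Output undefined"]) simp
next
  case (Suc r)
  show ?case
  proof (cases "U = {}")
    case True
    then show ?thesis by (intro exI[of _ "Output undefined"]) simp
  next
    case False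
    obtain \<C> where \<C>: "finite \<C>" "container_family k \<phi> U \<C>" and "card \<C> \<le> 2 ^ B"
      using ex_container_family[OF Suc.prems(1) False Suc.prems(2) k] B le_trans by blast
    define S where "S = {C \<in> \<C>. C \<subseteq> U \<and> 4 * card C \<le> 3 * card U}"
    have "finite S" "card S \<le> card \<C>"
      using \<C>(1) unfolding S_def by (auto intro: card_mono)
    with \<open>card \<C> \<le> 2 ^ B\<close> have S: "finite S" "card S \<le> 2 ^ B" by simp_all
    define solves where "solves C P \<longleftrightarrow> (\<forall>a b. bits_exchanged P a b \<le> r * (B + 1)) \<and>
        (\<forall>a b. separated k \<phi> C (X (owned p a b)) (Y (owned q a b)) \<longrightarrow>
          (\<forall>x\<in>C. (x \<in> X (owned p a b) \<longrightarrow> run P a b x) \<and> (x \<in> Y (owned q a b) \<longrightarrow> \<not> run P a b x)))"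
      for C and P :: "('i, 'i, 'x \<Rightarrow> bool) protocol"
    have "\<forall>C\<in>S. \<exists>P. solves C P"
      unfolding solves_def
    proof (intro ballI Suc.IH)
      fix C assume C: "C \<in> S"
      then have "C \<subseteq> U" by (simp add: S_def)
      then show "finite C" "\<phi> ` C \<subseteq> coord_space k"
        using Suc.prems(1,2) by (auto intro: finite_subset)
      have "4 * (3 ^ r * card C) \<le> 3 ^ Suc r * card U" using C by (simp add: S_def)
      also have "\<dots> < 4 ^ Suc r" by (rule Suc.prems(3))
      finally show "3 ^ r * card C < 4 ^ r" by simp
    qed
    from bchoice[OF this] obtain P where P: "\<forall>C\<in>S. solves C (P C)" ..
    \<comment> \<open>Whether a container covers the own sample can be checked without the other
      input.\<close>
    define ok where "ok Z i C \<longleftrightarrow> C \<in> S \<and> Z i \<inter> U \<subseteq> C" for Z :: "'i \<Rightarrow> 'x set" and i C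
    define g where "g Z i = (SOME C. ok Z i C)" for Z i
    have g: "ok Z i (g Z i)" if "\<exists>C. ok Z i C" for Z i
      unfolding g_def using that by (rule someI_ex)
    \<comment> \<open>Outside the container of \<open>X\<close> there is no point of
      \<open>X\<close>, so \<open>False\<close> is safe there; outside that of \<open>Y\<close>,
      \<open>True\<close> is.\<close>
    define K where "K out C = bind_protocol (P C) (\<lambda>f. Output (\<lambda>x. if x \<in> C then f x else out))"
      for out C
    have K: "bits_exchanged (K out C) a b \<le> r * (B + 1)" if "C \<in> S" for out C a b
      using bspec[OF P that] by (simp add: K_def solves_def)
    have run_K: "(x \<in> X (owned p a b) \<longrightarrow> run (K out C) a b x) \<and>
        (x \<in> Y (owned q a b) \<longrightarrow> \<not> run (K out C) a b x)"
      if "C \<in> S" "separated k \<phi> U (X (owned p a b)) (Y (owned q a b))" "x \<in> C" for C a b x out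
    proof -
      have "separated k \<phi> C (X (owned p a b)) (Y (owned q a b))"
        using that(1,2) separated_subset unfolding S_def by blast
      then show ?thesis using bspec[OF P that(1)] that(3) by (simp add: K_def solves_def)
    qed
    have run_K_out: "run (K out C) a b x = out" if "x \<notin> C" for out C a b x
      using that by (simp add: K_def)
    obtain QX where QX: "\<forall>a b. bits_exchanged QX a b \<le> B + r * (B + 1)"
      "\<forall>a b. g X (owned p a b) \<in> S \<longrightarrow> run QX a b = run (K False (g X (owned p a b))) a b"
      using ex_send_protocol[where K = "K False" and p = p and g = "g X", OF S K] by blast
    obtain QY where QY: "\<forall>a b. bits_exchanged QY a b \<le> B + r * (B + 1)"
      "\<forall>a b. g Y (owned q a b) \<in> S \<longrightarrow> run QY a b = run (K True (g Y (owned q a b))) a b"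
      using ex_send_protocol[where K = "K True" and p = q and g = "g Y", OF S K] by blast
    let ?P = "ask p (\<lambda>i. \<exists>C. ok X i C) QX QY"
    have "(x \<in> X (owned p a b) \<longrightarrow> run ?P a b x) \<and> (x \<in> Y (owned q a b) \<longrightarrow> \<not> run ?P a b x)"
      if sep: "separated k \<phi> U (X (owned p a b)) (Y (owned q a b))" and x: "x \<in> U" for a b x
    proof (cases "\<exists>C. ok X (owned p a b) C")
      case True
      let ?C = "g X (owned p a b)"
      have C: "?C \<in> S" "X (owned p a b) \<inter> U \<subseteq> ?C" using g[OF True] by (simp_all add: ok_def)
      have "run ?P a b = run QX a b" unfolding run_ask by (rule if_P[OF True])
      also have "\<dots> = run (K False ?C) a b" using QX(2) C(1) by blast
      finally have "run ?P a b = run (K False ?C) a b" .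
      then show ?thesis
        using run_K[OF C(1) sep, of x False] run_K_out[of x ?C False a b] C(2) x by (cases "x \<in> ?C") auto
    next
      case False
      \<comment> \<open>The refusal of the owner of \<open>X\<close> guarantees, under the promise,
        that the owner of \<open>Y\<close> has a container.\<close>
      then have ex: "\<exists>C. ok Y (owned q a b) C"
        using ex_shrinking_container[OF Suc.prems(1) \<C>(2) sep] unfolding ok_def S_def by blast
      let ?C = "g Y (owned q a b)"
      have C: "?C \<in> S" "Y (owned q a b) \<inter> U \<subseteq> ?C" using g[OF ex] by (simp_all add: ok_def)
      have "run ?P a b = run QY a b" unfolding run_ask by (rule if_not_P[OF False])
      also have "\<dots> = run (K True ?C) a b" using QY(2) C(1) by blast
      finally have "run ?P a b = run (K True ?C) a b" .
      then show ?thesis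
        using run_K[OF C(1) sep, of x True] run_K_out[of x ?C True a b] C(2) x by (cases "x \<in> ?C") auto
    qed
    moreover have "bits_exchanged ?P a b \<le> Suc r * (B + 1)" for a b
      using QX(1)[rule_format, of a b] QY(1)[rule_format, of a b] by (simp add: bits_ask)
    ultimately show ?thesis by (intro exI[of _ ?P] conjI allI impI ballI) simp_all
  qed
qed

section \<open>From halfspaces to linear separation\<close>

definition homogenize :: "nat \<Rightarrow> real vec \<Rightarrow> nat \<Rightarrow> real" where
  "homogenize d x = (\<lambda>i. if i < d then x $ i else if i = d then 1 else 0)"

lemma homogenize_in_coord_space: "homogenize d x \<in> coord_space (Suc d)"
  by (simp add: homogenize_def coord_space_def)

lemma ex_between_finite:
  fixes L G :: "real set"
  assumes "finite L" "finite G" "\<And>l g. l \<in> L \<Longrightarrow> g \<in> G \<Longrightarrow> l < g"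
  shows "\<exists>c. (\<forall>l\<in>L. l < c) \<and> (\<forall>g\<in>G. c < g)"
proof -
  consider "L = {}" | "G = {}" | "L \<noteq> {}" "G \<noteq> {}" by blast
  then show ?thesis
  proof cases
    case 1
    have "Min G - 1 < g" if "g \<in> G" for g using Min_le[OF assms(2) that] by linarith
    then show ?thesis using 1 by blast
  next
    case 2
    have "l < Max L + 1" if "l \<in> L" for l using Max_ge[OF assms(1) that] by linarith
    then show ?thesis using 2 by blast
  next
    case 3
    then have "Max L < Min G" using assms by auto
    then obtain c where "Max L < c" "c < Min G" using dense by blast
    then show ?thesis using 3 assms by auto
  qed
qed

text \<open>As \<open>U\<close> is finite, the threshold can be moved strictly between the values of
  \<open>a\<close> on \<open>U \<inter> H\<close> and on \<open>U - H\<close>. Open and closed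
  halfspaces are thus treated alike, and no point of \<open>U\<close> lies on the boundary.\<close>

lemma halfspace_strictly_separates:
  assumes H: "halfspace d H" and U: "finite U" "U \<subseteq> carrier_vec d"
  shows "\<exists>h\<in>coord_space (Suc d). \<forall>x\<in>U.
    (x \<in> H \<longrightarrow> dot (Suc d) h (homogenize d x) < 0) \<and> (x \<notin> H \<longrightarrow> dot (Suc d) h (homogenize d x) > 0)"
proof -
  obtain a b where a: "a \<in> carrier_vec d"
    and H': "H = {x \<in> carrier_vec d. a \<bullet> x < b} \<or> H = {x \<in> carrier_vec d. a \<bullet> x \<le> b}"
    using H unfolding halfspace_def by blast
  have lt: "a \<bullet> x < a \<bullet> y" if "x \<in> U \<inter> H" "y \<in> U - H" for x y
    using that U(2) H' by auto
  have "\<exists>c. (\<forall>l\<in>(\<lambda>x. a \<bullet> x) ` (U \<inter> H). l < c) \<and> (\<forall>g\<in>(\<lambda>x. a \<bullet> x) ` (U - H). c < g)"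
    using U(1) lt by (intro ex_between_finite) auto
  then obtain c where c: "\<And>x. x \<in> U \<inter> H \<Longrightarrow> a \<bullet> x < c" "\<And>x. x \<in> U - H \<Longrightarrow> c < a \<bullet> x"
    by blast
  define h where "h = (\<lambda>i. if i < d then a $ i else if i = d then - c else 0)"
  have "dot (Suc d) h (homogenize d x) = a \<bullet> x - c" if "x \<in> U" for x
  proof -
    have "x \<in> carrier_vec d" using that U(2) by blast
    then have "a \<bullet> x = (\<Sum>i<d. a $ i * x $ i)"
      by (simp add: scalar_prod_def atLeast0LessThan)
    moreover have "(\<Sum>i<d. h i * homogenize d x i) = (\<Sum>i<d. a $ i * x $ i)"
      by (intro sum.cong) (auto simp: h_def homogenize_def)
    ultimately show ?thesis by (simp add: dot_def) (simp add: h_def homogenize_def)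
  qed
  moreover have "h \<in> coord_space (Suc d)" by (simp add: h_def coord_space_def)
  ultimately show ?thesis using c by (intro bexI[of _ h]) auto
qed

section \<open>Logarithmic bounds\<close>

lemma log_pos_ge_1: "log_pos n \<ge> 1"
  by (simp add: log_pos_def)

text \<open>Rounding the logarithm up adds at most 1, which the lower bound 1 on
  \<open>log_pos\<close> absorbs into the factor 2.\<close>

lemma ex_power_two_bound: "\<exists>j. n < 2 ^ j \<and> real j \<le> 2 * log_pos n"
proof (cases "n = 0")
  case True
  then show ?thesis using log_pos_ge_1[of n] by (intro exI[of _ 0]) auto
next
  case False
  define j where "j = Suc (nat \<lfloor>log 2 (real n)\<rfloor>)"
  have log0: "log 2 (real n) \<ge> 0" using False by simp
  then have "log 2 (real n) < real j" "real j \<le> log 2 (real n) + 1"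
    unfolding j_def by linarith+
  then have "real n < 2 powr real j" using False by (simp add: log_less_iff)
  then have "real n < real (2 ^ j)" by (simp add: powr_realpow)
  then have "n < 2 ^ j" by (simp only: of_nat_less_iff)
  moreover have "real j \<le> 2 * log_pos n"
    using \<open>real j \<le> log 2 (real n) + 1\<close> by (simp add: log_pos_def)
  ultimately show ?thesis by blast
qed

text \<open>With \<open>64 * k ^ 3 + k\<close> at most \<open>2 ^ (7 + 3 * l)\<close>, the first
  factor is at most 4 times this; the exponents sum to 2 + 2(7 + 3l). A container thus costs O(k log
  k) bits.\<close>

lemma number_of_containers_bound:
  fixes k l :: nat
  assumes "k \<ge> 1" "k \<le> 2 ^ l"
  shows "((2 * (64 * k ^ 3 + k) + 1) * (64 * k ^ 3 + k)) ^ k \<le> 2 ^ ((16 + 6 * l) * k)"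
proof -
  have "k \<le> k ^ 3" using assms(1) by (intro self_le_power) auto
  then have "64 * k ^ 3 + k \<le> 128 * k ^ 3" by linarith
  also have "\<dots> \<le> 128 * (2 ^ l) ^ 3" using assms(2) by (intro mult_le_mono power_mono) auto
  also have "\<dots> = 2 ^ (7 + 3 * l)" by (simp add: power_add power_mult[symmetric] mult.commute)
  finally have m: "64 * k ^ 3 + k \<le> 2 ^ (7 + 3 * l)" .
  then have "2 * (64 * k ^ 3 + k) + 1 \<le> 4 * 2 ^ (7 + 3 * l)"
  proof -
    have "2 * a + 1 \<le> 4 * b" if "a \<le> b" "1 \<le> b" for a b :: nat using that by linarith
    from this[OF m] show ?thesis by simp
  qed
  then have "(2 * (64 * k ^ 3 + k) + 1) * (64 * k ^ 3 + k) \<le> (4 * 2 ^ (7 + 3 * l)) * 2 ^ (7 + 3 * l)"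
    using m by (rule mult_le_mono)
  also have "\<dots> = 2 ^ (16 + 6 * l)"
  proof -
    have "16 + 6 * l = 2 + (7 + 3 * l) + (7 + 3 * l)" by simp
    then show ?thesis by (simp only: power_add) simp
  qed
  finally show ?thesis unfolding power_mult by (rule power_mono) simp
qed

section \<open>The protocol for learning halfspaces\<close>

lemma halfspace_carrier: "halfspace d (carrier_vec d)"
  unfolding halfspace_def by (intro bexI[of _ "0\<^sub>v d"] exI[of _ 0]) (auto simp: scalar_prod_left_zero)

text \<open>Two empty samples keep the promise. Nonemptiness turns a pointwise bit bound into one on
  the supremum.\<close>

lemma halfspace_inputs_nonempty: "halfspace_inputs d U \<noteq> {}"
proof -
  have "({}, {}) \<in> halfspace_inputs d U"
    using halfspace_carrier by (auto simp: halfspace_inputs_def sample_over_def)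
  then show ?thesis by blast
qed

text \<open>Run the one-sided protocol for each choice of the player \<open>p\<close> whose positive points and the player
  \<open>q\<close> whose negative points are separated. The label is \<open>1\<close> iff for some \<open>p\<close> both runs say so.\<close>

lemma ex_halfspace_protocol:
  fixes U :: "real vec set"
  assumes U: "finite U" "U \<subseteq> carrier_vec d"
    and B: "((2 * (64 * Suc d ^ 3 + Suc d) + 1) * (64 * Suc d ^ 3 + Suc d)) ^ Suc d \<le> 2 ^ B"
    and r: "3 ^ r * card U < 4 ^ r"
  shows "\<exists>P :: (sample, sample, real vec \<Rightarrow> int) protocol. learns_halfspaces d U P \<and>
    (\<forall>a b. bits_exchanged P a b \<le> 4 * (r * (B + 1)))"
proof -
  let ?k = "Suc d" and ?\<phi> = "homogenize d"
  define Pos where "Pos S = {x. (x, 1) \<in> S}" for S :: sample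
  define Neg where "Neg S = {x. (x, -1) \<in> S}" for S :: sample
  have \<phi>: "?\<phi> ` U \<subseteq> coord_space ?k" using homogenize_in_coord_space by blast
  define solves where "solves p q P \<longleftrightarrow> (\<forall>a b. bits_exchanged P a b \<le> r * (B + 1)) \<and>
    (\<forall>a b. separated ?k ?\<phi> U (Pos (owned p a b)) (Neg (owned q a b)) \<longrightarrow>
      (\<forall>x\<in>U. (x \<in> Pos (owned p a b) \<longrightarrow> run P a b x) \<and> (x \<in> Neg (owned q a b) \<longrightarrow> \<not> run P a b x)))"
    for p q and P :: "(sample, sample, real vec \<Rightarrow> bool) protocol"
  have "\<exists>P. solves p q P" for p q
    unfolding solves_def by (rule ex_one_sided_protocol[OF _ B U(1) \<phi> r]) simp
  then have "\<forall>p. \<exists>Rp. \<forall>q. solves p q (Rp q)" by (intro allI choice)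
  from choice[OF this] obtain R where R: "\<forall>p q. solves p q (R p q)" ..
  have bits_R: "bits_exchanged (R p q) a b \<le> r * (B + 1)" for p q a b
    using R by (simp add: solves_def)
  have run_R: "(x \<in> Pos (owned p a b) \<longrightarrow> run (R p q) a b x) \<and>
      (x \<in> Neg (owned q a b) \<longrightarrow> \<not> run (R p q) a b x)"
    if "separated ?k ?\<phi> U (Pos (owned p a b)) (Neg (owned q a b))" "x \<in> U" for p q a b x
  proof -
    have "solves p q (R p q)" using R by blast
    from conjunct2[OF this[unfolded solves_def], rule_format, OF that] show ?thesis .
  qed
  define P where "P = bind_protocol (R True True) (\<lambda>f1. bind_protocol (R True False) (\<lambda>f2.
    bind_protocol (R False True) (\<lambda>f3. bind_protocol (R False False) (\<lambda>f4.
      Output (\<lambda>x. if f1 x \<and> f2 x \<or> f3 x \<and> f4 x then 1 else - 1 :: int)))))"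
  have run: "run P a b x = (if run (R True True) a b x \<and> run (R True False) a b x \<or>
      run (R False True) a b x \<and> run (R False False) a b x then 1 else - 1)" for a b x
    by (simp add: P_def)
  have bits: "bits_exchanged P a b \<le> 4 * (r * (B + 1))" for a b
    using bits_R[of True True a b] bits_R[of True False a b] bits_R[of False True a b]
      bits_R[of False False a b]
    by (simp add: P_def)
  have correct: "(\<forall>x\<in>U. run P Sa Sb x \<in> {1, -1}) \<and> (\<forall>(x, y)\<in>Sa \<union> Sb. run P Sa Sb x = y)"
    if inp: "(Sa, Sb) \<in> halfspace_inputs d U" for Sa Sb
  proof -
    have over: "Sa \<subseteq> U \<times> {1, -1}" "Sb \<subseteq> U \<times> {1, -1}"
      using inp by (simp_all add: halfspace_inputs_def sample_over_def)
    obtain H where H: "halfspace d H" "\<forall>x. (x, 1) \<in> Sa \<union> Sb \<longrightarrow> x \<in> H"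
      "\<forall>x. (x, -1) \<in> Sa \<union> Sb \<longrightarrow> x \<notin> H"
      using inp unfolding halfspace_inputs_def mem_Collect_eq case_prod_conv by (elim exE conjE)
    obtain h where h: "h \<in> coord_space ?k"
      "\<forall>x\<in>U. (x \<in> H \<longrightarrow> dot ?k h (?\<phi> x) < 0) \<and> (x \<notin> H \<longrightarrow> dot ?k h (?\<phi> x) > 0)"
      using halfspace_strictly_separates[OF H(1) U] by (elim bexE)
    have own: "owned p Sa Sb \<subseteq> Sa \<union> Sb" for p by simp
    \<comment> \<open>The promise concerns the union of the samples, so the same \<open>h\<close>
      works for all four pairings.\<close>
    have sep: "separated ?k ?\<phi> U (Pos (owned p Sa Sb)) (Neg (owned q Sa Sb))" for p q
      unfolding separated_def
    proof (intro bexI[OF _ h(1)] ballI conjI impI)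
      fix x assume x: "x \<in> U"
      have neg: "x \<in> H \<Longrightarrow> dot ?k h (?\<phi> x) < 0" and pos: "x \<notin> H \<Longrightarrow> dot ?k h (?\<phi> x) > 0"
        using bspec[OF h(2) x] by simp_all
      then show "dot ?k h (?\<phi> x) \<noteq> 0" by (cases "x \<in> H") auto
      show "dot ?k h (?\<phi> x) < 0" if "x \<in> Pos (owned p Sa Sb)"
      proof (rule neg)
        have "(x, 1) \<in> owned p Sa Sb" using that unfolding Pos_def by (rule CollectD)
        then show "x \<in> H" using own H(2) by blast
      qed
      show "dot ?k h (?\<phi> x) > 0" if "x \<in> Neg (owned q Sa Sb)"
      proof (rule pos)
        have "(x, -1) \<in> owned q Sa Sb" using that unfolding Neg_def by (rule CollectD)
        then show "x \<notin> H" using own H(3) by blast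
      qed
    qed
    have R': "(x \<in> Pos (owned p Sa Sb) \<longrightarrow> run (R p q) Sa Sb x) \<and>
        (x \<in> Neg (owned q Sa Sb) \<longrightarrow> \<not> run (R p q) Sa Sb x)" if "x \<in> U" for p q x
      using run_R[OF sep that] .
    have "run P Sa Sb x = y" if xy: "(x, y) \<in> Sa \<union> Sb" for x y
    proof -
      have x: "x \<in> U" and y: "y = 1 \<or> y = -1" using xy over by auto
      \<comment> \<open>A positive point of \<open>p\<close> is accepted by both runs of
        \<open>p\<close>, which makes one conjunction true. A negative point of \<open>q\<close> is
        rejected by \<open>R True q\<close> and by \<open>R False q\<close>, which makes both
        conjunctions false.\<close>
      consider "y = 1" "x \<in> Pos Sa" | "y = 1" "x \<in> Pos Sb" | "y = -1" "x \<in> Neg Sa" | "y = -1" "x \<in> Neg Sb"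
        using xy y unfolding Pos_def Neg_def by blast
      then show ?thesis
      proof cases
        case 1
        then show ?thesis using R'[OF x, of True True] R'[OF x, of True False] by (simp add: run)
      next
        case 2
        then show ?thesis using R'[OF x, of False True] R'[OF x, of False False] by (simp add: run)
      next
        case 3
        then show ?thesis using R'[OF x, of True True] R'[OF x, of False True] by (simp add: run)
      next
        case 4
        then show ?thesis using R'[OF x, of True False] R'[OF x, of False False] by (simp add: run)
      qed
    qed
    then show ?thesis by (auto simp: run)
  qed
  have "learns_halfspaces d U P"
    unfolding learns_halfspaces_def
    by (rule ballI, simp only: split_paired_all case_prod_conv, rule correct)
  with bits show ?thesis by blast
qed

theorem mainTheorem1:
  shows "\<exists>C::real. \<forall>(d::nat) (n::nat) (U::real vec set).
    d \<ge> 1 \<and> U \<subseteq> carrier_vec d \<and> finite U \<and> card U = n \<longrightarrow>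
    (\<exists>P :: (sample, sample, real vec \<Rightarrow> int) protocol.
       learns_halfspaces d U P \<and>
       real (communication_complexity (halfspace_inputs d U) P)
         \<le> C * (real d * log_pos d * log_pos n))"
proof (intro exI[of _ 1368] allI impI)
  fix d n :: nat and U :: "real vec set"
  assume *: "d \<ge> 1 \<and> U \<subseteq> carrier_vec d \<and> finite U \<and> card U = n"
  obtain j where j: "n < 2 ^ j" "real j \<le> 2 * log_pos n" using ex_power_two_bound by blast
  obtain l where l: "d < 2 ^ l" "real l \<le> 2 * log_pos d" using ex_power_two_bound by blast
  define B where "B = (16 + 6 * l) * Suc d"
  define r where "r = 3 * j"
  \<comment> \<open>Three rounds per factor 2 suffice because 27 * 2 = 54 <= 64.\<close>
  have "3 ^ r * card U < 3 ^ r * 2 ^ j" using * j(1) by simp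
  also have "\<dots> = 54 ^ j" by (simp add: r_def power_mult power_mult_distrib[symmetric])
  also have "\<dots> \<le> 64 ^ j" by (rule power_mono) auto
  also have "\<dots> = 4 ^ r" by (simp add: r_def power_mult)
  finally have r: "3 ^ r * card U < 4 ^ r" .
  have B: "((2 * (64 * Suc d ^ 3 + Suc d) + 1) * (64 * Suc d ^ 3 + Suc d)) ^ Suc d \<le> 2 ^ B"
    unfolding B_def using l(1) by (intro number_of_containers_bound) auto
  obtain P :: "(sample, sample, real vec \<Rightarrow> int) protocol"
    where P: "learns_halfspaces d U P" "\<And>a b. bits_exchanged P a b \<le> 4 * (r * (B + 1))"
    using ex_halfspace_protocol[OF _ _ B r] * by blast
  have "communication_complexity (halfspace_inputs d U) P \<le> 4 * (r * (B + 1))"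
    using P(2) communication_complexity_le_iff[OF halfspace_inputs_nonempty] by blast
  then have "real (communication_complexity (halfspace_inputs d U) P) \<le> real (4 * (r * (B + 1)))"
    by (simp only: of_nat_le_iff)
  also have "\<dots> = 12 * (real j * ((16 + 6 * real l) * (real d + 1) + 1))"
    by (simp add: r_def B_def algebra_simps)
  \<comment> \<open>The 12 stems from four runs and three rounds per unit of \<open>j\<close>. The
    57 is 28 * 2 + 1, using \<open>d \<ge> 1\<close> for \<open>d + 1 \<le> 2 * d\<close>;
    altogether 12 * 2 * 57 = 1368.\<close>
  also have "\<dots> \<le> 12 * ((2 * log_pos n) * (57 * (real d * log_pos d)))"
  proof (intro mult_left_mono mult_mono)
    let ?L = "log_pos d"
    have L: "?L \<ge> 1" by (rule log_pos_ge_1)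
    have d: "real d \<ge> 1" using * by simp
    have "(16 + 6 * real l) * (real d + 1) \<le> (28 * ?L) * (2 * real d)"
      using l(2) L d by (intro mult_mono) auto
    moreover have "1 \<le> real d * ?L" using mult_mono[OF d L] d by simp
    ultimately show "(16 + 6 * real l) * (real d + 1) + 1 \<le> 57 * (real d * ?L)"
      by (simp add: algebra_simps)
  qed (use j(2) log_pos_ge_1[of n] in auto)
  also have "\<dots> = 1368 * (real d * log_pos d * log_pos n)" by simp
  finally show "\<exists>P :: (sample, sample, real vec \<Rightarrow> int) protocol. learns_halfspaces d U P \<and>
      real (communication_complexity (halfspace_inputs d U) P)
        \<le> 1368 * (real d * log_pos d * log_pos n)"
    using P(1) by blast
qed

end
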